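(* Let $E/\mathbb{Q}$ be an elliptic curve without complex multiplication that has abelian entanglements, let $f$ be a positive integer and $a$ an integer, and for each prime $\ell$ let $e_\ell=\mathrm{ord}_\ell(f)$. Define $S(\ell)=\{A\in G(\ell^{e_\ell}):A\not\equiv I\pmod\ell,\ \det A\equiv a\pmod{\ell^{e_\ell}}\}$ if $\ell\mid f$, and $S(\ell)=G(\ell)\setminus\{I\}$ if $\ell\nmid f$; let $\delta_\ell=|S(\ell)|/|G(\ell^{\max(e_\ell,1)})|$. Let $m=\prod_{\ell\mid(f,m_E)}\ell^{e_\ell}\prod_{\ell\mid m_E,\,\ell\nmid f}\ell$, $\mathcal{G}_m=\prod_{\ell\mid m}G(\ell^{\mathrm{ord}_\ell m})$, $\Phi_m=\mathcal{G}_m/G(m)$ with quotient map $\psi_m$, and assume $S(\ell)\neq\emptyset$ for all $\ell\mid m$. For a character $\tilde\chi$ of $\Phi_m$ put $\chi=\tilde\chi\circ\psi_m$, let $\chi_\ell$ be its restriction to the factor $G(\ell^{\mathrm{ord}_\ell m})$, and $E_{\chi,\ell}=\frac{1}{|S(\ell)|}\sum_{x\in S(\ell)}\chi_\ell(x)$. Then $C_E(a,f)=\mathfrak{C}_E(a,f)\prod_\ell\delta_\ell$, where $$\mathfrak{C}_E(a,f)=1+\sum_{\tilde\chi\in\widehat{\Phi}_m\setminus\{1\}}\prod_{\ell\mid m}E_{\chi,\ell}.$$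
   Context: $G(n)\leqslant\mathrm{GL}_2(\mathbb{Z}/n\mathbb{Z})$ is the image of the mod-$n$ Galois representation of $E$, viewed via CRT inside the product of its prime-power components (normal with abelian quotient, as $E$ has abelian entanglements). For $x\geq2$ let $M_x=\prod_{\ell\leqslant x}\ell^{\max(e_\ell,1)}$ (primes $\ell$), and define $C_E(a,f)=\lim_{x\to\infty}\frac{|\{g\in G(M_x):\ g\bmod \ell^{\max(e_\ell,1)}\in S(\ell)\ \forall \ell\leqslant x\}|}{|G(M_x)|}$ (the conjectural density of primes $p$ with $\tilde E(\mathbb{F}_p)$ cyclic and $p\equiv a\pmod f$). Definitions: with $G\leqslant\mathrm{GL}_2(\widehat{\mathbb{Z}})$ the adelic image and $G_{n^\infty}$ its image in $\prod_{\ell\mid n}\mathrm{GL}_2(\mathbb{Z}_\ell)$, $n$ is stable if $G_{n^\infty}$ is the full preimage of $G(n)$, split if $G=G_{n^\infty}\times\prod_{\ell\nmid n}\mathrm{GL}_2(\mathbb{Z}_\ell)$; $m_E$ is the smallest split and stable positive integer. A subgroup $H\leqslant H_1\times\dots\times H_k$ surjecting onto each factor has abelian entanglements if for every partition $\{A,B\}$ of $\{1,\dots,k\}$ into nonempty sets the Goursat quotient $H_A/\{x\in H_A:(x,1)\in H\}$ is abelian ($H_A$ = image of $H$ in $\prod_{i\in A}H_i$); $E$ has abelian entanglements if $G(m_E)\leqslant\prod_{\ell^\alpha\|m_E}G(\ell^\alpha)$ does. *)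

theory Defs
  imports "HOL-Algebra.Algebra" "HOL-Analysis.Infinite_Products"
    "HOL-Computational_Algebra.Primes"
begin

text \<open>A 2x2 matrix ((a,b),(c,d)) is encoded as the quadruple (a,b,c,d);
  an element of GL2(Z/nZ) is such a quadruple with entries in 0..n-1
  (canonical residues) and determinant coprime to n.\<close>

type_synonym m2 = "int \<times> int \<times> int \<times> int"

fun mdet :: "m2 \<Rightarrow> int" where
  "mdet (a, b, c, d) = a * d - b * c"

fun red :: "nat \<Rightarrow> m2 \<Rightarrow> m2" where
  "red n (a, b, c, d) = (a mod int n, b mod int n, c mod int n, d mod int n)"

fun mmul :: "nat \<Rightarrow> m2 \<Rightarrow> m2 \<Rightarrow> m2" where
  "mmul n (a, b, c, d) (e, f, g, h) =
     red n (a * e + b * g, a * f + b * h, c * e + d * g, c * f + d * h)"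

definition ident :: "nat \<Rightarrow> m2" where
  "ident n = red n (1, 0, 0, 1)"

definition GL2 :: "nat \<Rightarrow> m2 set" where
  "GL2 n = {A. red n A = A \<and> coprime (mdet A) (int n)}"

definition GL2grp :: "nat \<Rightarrow> m2 monoid" where
  "GL2grp n = \<lparr>carrier = GL2 n, monoid.mult = mmul n, one = ident n\<rparr>"

text \<open>G n plays the role of G(n), the image in GL2(Z/nZ) of a closed subgroup
  of GL2(hat Z): subgroups, compatible under reduction maps.\<close>

definition compatible_system :: "(nat \<Rightarrow> m2 set) \<Rightarrow> bool" where
  "compatible_system G \<longleftrightarrow>
     (\<forall>n>0. subgroup (G n) (GL2grp n)) \<and>
     (\<forall>n d. 0 < n \<longrightarrow> d dvd n \<longrightarrow> red d ` G n = G d)"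

text \<open>n is split: G = G_{n^\<infinity>} \<times> prod_{l not dividing n} GL2(Z_l), checked at all finite levels.\<close>
definition split_level :: "(nat \<Rightarrow> m2 set) \<Rightarrow> nat \<Rightarrow> bool" where
  "split_level G n \<longleftrightarrow>
     (\<forall>N1 N2. 0 < N1 \<longrightarrow> 0 < N2 \<longrightarrow> (\<forall>p. Factorial_Ring.prime p \<longrightarrow> p dvd N1 \<longrightarrow> p dvd n) \<longrightarrow>
        coprime N2 n \<longrightarrow> G (N1 * N2) = {g \<in> GL2 (N1 * N2). red N1 g \<in> G N1})"

text \<open>n is stable: G_{n^\<infinity>} is the full preimage of G(n), checked at all finite levels.\<close>
definition stable_level :: "(nat \<Rightarrow> m2 set) \<Rightarrow> nat \<Rightarrow> bool" where
  "stable_level G n \<longleftrightarrow>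
     (\<forall>N. 0 < N \<longrightarrow> n dvd N \<longrightarrow> (\<forall>p. Factorial_Ring.prime p \<longrightarrow> p dvd N \<longrightarrow> p dvd n) \<longrightarrow>
        G N = {g \<in> GL2 N. red n g \<in> G n})"

definition mE :: "(nat \<Rightarrow> m2 set) \<Rightarrow> nat" where
  "mE G = (LEAST n. 0 < n \<and> split_level G n \<and> stable_level G n)"

definition ppart :: "nat \<Rightarrow> nat set \<Rightarrow> nat" where
  "ppart M A = (\<Prod>l\<in>A. l ^ multiplicity l M)"

definition abelian_entanglements :: "(nat \<Rightarrow> m2 set) \<Rightarrow> bool" where
  "abelian_entanglements G \<longleftrightarrow>
     (let M = mE G in
      \<forall>A B. A \<union> B = prime_factors M \<longrightarrow> A \<inter> B = {} \<longrightarrow> A \<noteq> {} \<longrightarrow> B \<noteq> {} \<longrightarrow>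
        (let nA = ppart M A; nB = ppart M B; HA = red nA ` G M;
             NA = {x \<in> HA. \<exists>h\<in>G M. red nA h = x \<and> red nB h = ident nB}
         in comm_group (((GL2grp nA)\<lparr>carrier := HA\<rparr>) Mod NA)))"

definition lev :: "nat \<Rightarrow> nat \<Rightarrow> nat" where
  "lev f l = l ^ max (multiplicity l f) 1"

definition Sset :: "(nat \<Rightarrow> m2 set) \<Rightarrow> nat \<Rightarrow> int \<Rightarrow> nat \<Rightarrow> m2 set" where
  "Sset G f a l =
     (if l dvd f then
        {A \<in> G (l ^ multiplicity l f). red l A \<noteq> ident l \<and>
             mdet A mod int (l ^ multiplicity l f) = a mod int (l ^ multiplicity l f)}
      else G l - {ident l})"

definition delta :: "(nat \<Rightarrow> m2 set) \<Rightarrow> nat \<Rightarrow> int \<Rightarrow> nat \<Rightarrow> real" where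
  "delta G f a l = real (card (Sset G f a l)) / real (card (G (lev f l)))"

definition Mx :: "nat \<Rightarrow> nat \<Rightarrow> nat" where
  "Mx f x = (\<Prod>l\<in>{p. Factorial_Ring.prime p \<and> p \<le> x}. lev f l)"

text \<open>Proportion whose limit (x \<rightarrow> \<infinity>) is C_E(a,f).\<close>
definition dens :: "(nat \<Rightarrow> m2 set) \<Rightarrow> nat \<Rightarrow> int \<Rightarrow> nat \<Rightarrow> real" where
  "dens G f a x =
     real (card {g \<in> G (Mx f x). \<forall>l. Factorial_Ring.prime l \<and> l \<le> x \<longrightarrow> red (lev f l) g \<in> Sset G f a l})
     / real (card (G (Mx f x)))"

definition mlev :: "(nat \<Rightarrow> m2 set) \<Rightarrow> nat \<Rightarrow> nat" where
  "mlev G f = (\<Prod>l\<in>{l \<in> prime_factors (mE G). l dvd f}. l ^ multiplicity l f)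
             * (\<Prod>l\<in>{l \<in> prime_factors (mE G). \<not> l dvd f}. l)"

text \<open>calG m = prod_{l | m} G(l^{ord_l m}), viewed inside GL2(Z/mZ) via CRT.\<close>
definition calG :: "(nat \<Rightarrow> m2 set) \<Rightarrow> nat \<Rightarrow> m2 set" where
  "calG G m = {g \<in> GL2 m. \<forall>l\<in>prime_factors m.
                 red (l ^ multiplicity l m) g \<in> G (l ^ multiplicity l m)}"

definition calGgrp :: "(nat \<Rightarrow> m2 set) \<Rightarrow> nat \<Rightarrow> m2 monoid" where
  "calGgrp G m = (GL2grp m)\<lparr>carrier := calG G m\<rparr>"

definition Phi :: "(nat \<Rightarrow> m2 set) \<Rightarrow> nat \<Rightarrow> m2 set monoid" where
  "Phi G m = calGgrp G m Mod G m"

definition psi :: "(nat \<Rightarrow> m2 set) \<Rightarrow> nat \<Rightarrow> m2 \<Rightarrow> m2 set" where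
  "psi G m g = G m #>\<^bsub>calGgrp G m\<^esub> g"

text \<open>Characters of a (finite) group: multiplicative maps to the complex numbers
  sending 1 to 1 (hence into the nonzero complex numbers), extensional.\<close>
definition characters :: "('a, 'b) monoid_scheme \<Rightarrow> ('a \<Rightarrow> complex) set" where
  "characters H = {chi \<in> carrier H \<rightarrow>\<^sub>E UNIV. chi \<one>\<^bsub>H\<^esub> = 1 \<and>
      (\<forall>x\<in>carrier H. \<forall>y\<in>carrier H. chi (x \<otimes>\<^bsub>H\<^esub> y) = chi x * chi y)}"

definition trivial_character :: "('a, 'b) monoid_scheme \<Rightarrow> 'a \<Rightarrow> complex" where
  "trivial_character H = (\<lambda>x\<in>carrier H. 1)"

text \<open>Embedding of the factor G(l^k) (k = ord_l m) into calG m: the element congruent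
  to x mod l^k and to the identity mod m / l^k.\<close>
definition emb :: "nat \<Rightarrow> nat \<Rightarrow> m2 \<Rightarrow> m2" where
  "emb m l x = (THE g. g \<in> GL2 m \<and> red (l ^ multiplicity l m) g = x \<and>
                  red (m div l ^ multiplicity l m) g = ident (m div l ^ multiplicity l m))"

definition Echi :: "(nat \<Rightarrow> m2 set) \<Rightarrow> nat \<Rightarrow> int \<Rightarrow> (m2 set \<Rightarrow> complex) \<Rightarrow> nat \<Rightarrow> complex" where
  "Echi G f a chi l =
     (\<Sum>x\<in>Sset G f a l. chi (psi G (mlev G f) (emb (mlev G f) l x)))
       / of_nat (card (Sset G f a l))"

definition frakC :: "(nat \<Rightarrow> m2 set) \<Rightarrow> nat \<Rightarrow> int \<Rightarrow> complex" where
  "frakC G f a = 1 + (\<Sum>chi\<in>characters (Phi G (mlev G f)) - {trivial_character (Phi G (mlev G f))}.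
                        \<Prod>l\<in>prime_factors (mlev G f). Echi G f a chi l)"

end

theory Submission
  imports Defs "HOL-Number_Theory.Cong"
begin

text \<open>
  Write M for the split and stable level. The Goursat quotients for the partitions of the primes of M
  into one prime and the rest show that each commutator of G(q), q a prime power exactly dividing M,
  lies in G(M) when padded by 1 at the other primes; hence the commutators of the full product lie in
  G(M), and stability carries this over to the level m. So the quotient of the product by G(m) is a
  finite abelian group, the indicator of G(m) is the average of its characters, and summing a
  character over the product of the sets S(l) factors over the primes dividing m. The primes outside M
  contribute independent factors because M is split, and the product of these converges because
  the deviation of \<delta>(l) from 1 is at most 1 / (l * l) for almost all l.
\<close>

section \<open>Characters of finite abelian groups\<close>

text \<open>The entanglement hypothesis concerns the level \<open>mE G\<close>, while the counting
  takes place at \<open>mlev G f\<close>. These levels have the same primes, but in general neither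
  divides the other, so commutators travel through a common multiple, and this is where stability
  enters. Partitions into one prime and the rest suffice because a commutator in the product group
  is the product of its local commutators, each padded by 1 elsewhere. Orthogonality does not rest
  on a decomposition into cyclic factors: a character of a subgroup is extended by adjoining one
  element at a time, with a value that is any suitable root of one already prescribed. The bound 1 /
  (l * l) needs no exact group order, only l * l matrices of determinant 1 with two free entries.
  The correction factor is built from means over S(l), and nonempty S(l) are what allows sums to be
  recovered from means.\<close>

definition multiplicative_on :: "('a, 'b) monoid_scheme \<Rightarrow> 'a set \<Rightarrow> ('a \<Rightarrow> complex) \<Rightarrow> bool" where
  "multiplicative_on G H chi \<longleftrightarrow>
     chi \<one>\<^bsub>G\<^esub> = 1 \<and> (\<forall>x\<in>H. \<forall>y\<in>H. chi (x \<otimes>\<^bsub>G\<^esub> y) = chi x * chi y)"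

context group
begin

lemma multiplicative_on_inv:
  assumes "multiplicative_on G H chi" "subgroup H G" "y \<in> H"
  shows "chi y \<noteq> 0" "chi (inv y) = inverse (chi y)"
proof -
  have y: "y \<in> carrier G" "inv y \<in> H"
    using assms subgroup.mem_carrier subgroup.m_inv_closed by metis+
  have "chi y * chi (inv y) = 1"
    using assms y unfolding multiplicative_on_def by (metis r_inv)
  then show "chi y \<noteq> 0" "chi (inv y) = inverse (chi y)"
    by (auto intro: inverse_unique[symmetric])
qed

lemma multiplicative_on_pow:
  assumes "multiplicative_on G H chi" "subgroup H G" "y \<in> H"
  shows "y [^] (k::nat) \<in> H \<and> chi (y [^] k) = chi y ^ k"
proof (induction k)
  case 0
  then show ?case
    using assms by (auto simp: multiplicative_on_def subgroup.one_closed)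
next
  case (Suc k)
  then show ?case
    using assms by (auto simp: multiplicative_on_def subgroup.m_closed)
qed

lemma multiplicative_on_int_pow:
  assumes "multiplicative_on G H chi" "subgroup H G" "y \<in> H"
  shows "y [^] (k::int) \<in> H \<and> chi (y [^] k) = chi y powi k"
proof (cases "k \<ge> 0")
  case True
  then obtain m where "k = int m" by (metis nonneg_int_cases)
  then show ?thesis
    using multiplicative_on_pow[OF assms, of m] by (simp add: int_pow_int)
next
  case False
  define m where "m = nat (- k)"
  have m: "k = - int m" using False by (simp add: m_def)
  have y: "y \<in> carrier G" using assms subgroup.mem_carrier by metis
  have "y [^] k = inv (y [^] m)"
    using y m by (simp add: int_pow_neg int_pow_int)
  then show ?thesis
    using multiplicative_on_pow[OF assms, of m] multiplicative_on_inv[OF assms(1,2)] m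
    by (auto simp: power_int_minus subgroup.m_inv_closed[OF assms(2)])
qed

end

section \<open>Extending characters from a subgroup\<close>

context comm_group
begin

text \<open>Adjoining x leaves a free choice: any n-th root z of the value at x^n can be the value
  at x. The extension sends h x^k to \<open>chi h * z powi k\<close>. The freedom in z is what later
  separates x from the identity.\<close>

lemma extend_character_step:
  fixes z :: complex
  assumes H: "subgroup H G"
    and chi: "multiplicative_on G H chi" and x: "x \<in> carrier G"
    and n: "n > 0" "x [^] n \<in> H" "\<And>k::nat. 0 < k \<Longrightarrow> x [^] k \<in> H \<Longrightarrow> n \<le> k"
    and z: "z ^ n = chi (x [^] n)"
  obtains H' chi' where "subgroup H' G" "H \<subseteq> H'" "x \<in> H'" "multiplicative_on G H' chi'"
    "\<And>h. h \<in> H \<Longrightarrow> chi' h = chi h" "chi' x = z"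
proof -
  note Hc = subgroup.mem_carrier[OF H] and Hm = subgroup.m_closed[OF H]
    and Hi = subgroup.m_inv_closed[OF H] and H1 = subgroup.one_closed[OF H]
  have z0: "z \<noteq> 0"
    using z n(1,2) multiplicative_on_inv(1)[OF chi H n(2)] by (metis power_0_left neq0_conv)
  \<comment> \<open>Division by n with remainder and the minimality of n show that a power of x
    lying in H has exponent divisible by n, and on such powers z agrees with \<open>chi\<close> by
    its choice.\<close>
  have key: "chi (x [^] j) = z powi j" if j: "x [^] j \<in> H" for j :: int
  proof -
    define q r where "q = j div int n" and "r = j mod int n"
    have jqr: "j = int n * q + r" by (simp add: q_def r_def)
    have r: "0 \<le> r" "r < int n" using n(1) by (auto simp: r_def)
    have nq: "(x [^] n) [^] q \<in> H" "chi ((x [^] n) [^] q) = chi (x [^] n) powi q"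
      using multiplicative_on_int_pow[OF chi H n(2)] by auto
    have eq: "(x [^] n) [^] q = x [^] (int n * q)"
      using x by (simp add: int_pow_pow flip: int_pow_int)
    have "x [^] r = inv (x [^] (int n * q)) \<otimes> x [^] j"
      unfolding jqr using x by (simp add: int_pow_mult[symmetric] flip: int_pow_neg)
    then have "x [^] r \<in> H" using nq eq j by (simp add: Hm Hi)
    then have "x [^] (nat r) \<in> H" using r by (metis int_pow_int nat_0_le)
    then have "r = 0" using n(3)[of "nat r"] r by (cases "nat r = 0") auto
    then have "j = int n * q" using jqr by simp
    then show ?thesis
      using nq z by (simp add: eq power_int_mult)
  qed
  define H' where "H' = {h \<otimes> x [^] (k::int) | h k. h \<in> H}"
  define chi' where "chi' y = (SOME v. \<exists>h k. h \<in> H \<and> y = h \<otimes> x [^] (k::int) \<and> v = chi h * z powi k)" for y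
  \<comment> \<open>Two representations of one element differ by a power of x that lies in H, the
    case settled by \<open>key\<close>. Hence the value is independent of the
    representation.\<close>
  have wd: "chi h * z powi k = chi h' * z powi k'"
    if "h \<in> H" "h' \<in> H" "h \<otimes> x [^] k = h' \<otimes> x [^] k'" for h h' and k k' :: int
  proof -
    have "x [^] (k - k') = x [^] k \<otimes> inv (x [^] k')"
      using x by (simp add: int_pow_diff)
    also have "\<dots> = inv h \<otimes> h'"
      using that x Hc by (metis (no_types, lifting) int_pow_closed inv_closed inv_solve_left inv_solve_right m_assoc m_closed)
    finally have e: "x [^] (k - k') = inv h \<otimes> h'" .
    then have i: "x [^] (k - k') \<in> H" using that by (simp add: Hm Hi)
    have "h' = h \<otimes> x [^] (k - k')"
      using e that Hc x by (simp add: m_assoc[symmetric])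
    then have "chi h' = chi h * z powi (k - k')"
      using chi that i key by (metis multiplicative_on_def)
    then show ?thesis using z0 by (simp add: power_int_diff)
  qed
  have chi': "chi' (h \<otimes> x [^] k) = chi h * z powi k" if "h \<in> H" for h and k :: int
  proof -
    have "\<exists>v. \<exists>h' k'. h' \<in> H \<and> h \<otimes> x [^] k = h' \<otimes> x [^] (k'::int) \<and> v = chi h' * z powi k'"
      using that by blast
    from someI_ex[OF this] show ?thesis unfolding chi'_def using wd that by metis
  qed
  have mult: "(h \<otimes> x [^] k) \<otimes> (h' \<otimes> x [^] k') = (h \<otimes> h') \<otimes> x [^] (k + k')"
    if "h \<in> H" "h' \<in> H" for h h' and k k' :: int
    using that Hc x by (simp add: int_pow_mult m_ac)
  show ?thesis
  proof (rule that[of H' chi'])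
    show "subgroup H' G"
    proof (rule subgroupI)
      show "H' \<subseteq> carrier G" using Hc x by (auto simp: H'_def)
      show "H' \<noteq> {}" using H1 by (auto simp: H'_def)
      show "inv a \<in> H'" if aH: "a \<in> H'" for a
      proof -
        obtain h k where a: "h \<in> H" "a = h \<otimes> x [^] (k::int)" using aH by (auto simp: H'_def)
        have "inv a = inv h \<otimes> x [^] (- k)" using a Hc x by (simp add: inv_mult int_pow_neg)
        then show ?thesis using a Hi by (auto simp: H'_def)
      qed
      show "a \<otimes> b \<in> H'" if "a \<in> H'" "b \<in> H'" for a b
        using that mult Hm unfolding H'_def by blast
    qed
    have 0: "h = h \<otimes> x [^] (0::int)" if "h \<in> H" for h using that Hc by simp
    show "H \<subseteq> H'"
    proof
      show "h \<in> H'" if "h \<in> H" for h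
        using 0[OF that] that unfolding H'_def by blast
    qed
    have 1: "x = \<one> \<otimes> x [^] (1::int)" using x by (simp add: int_pow_1)
    show "x \<in> H'" using 1 H1 unfolding H'_def by blast
    have one: "chi \<one> = 1" using chi by (simp add: multiplicative_on_def)
    show "chi' h = chi h" if "h \<in> H" for h using chi'[OF that, of 0] 0[OF that] by simp
    then show "multiplicative_on G H' chi'"
      using chi' mult Hm chi z0 H1
      by (auto simp: multiplicative_on_def H'_def power_int_add)
    show "chi' x = z" using chi'[OF H1, of 1] 1 one by simp
  qed
qed

lemma least_power_in_subgroup:
  assumes fin: "finite (carrier G)" and H: "subgroup H G" and x: "x \<in> carrier G"
  obtains n :: nat where "n > 0" "x [^] n \<in> H" "\<And>k::nat. 0 < k \<Longrightarrow> x [^] k \<in> H \<Longrightarrow> n \<le> k"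
proof -
  define P where "P k \<longleftrightarrow> 0 < k \<and> x [^] (k::nat) \<in> H" for k
  \<comment> \<open>The group order is an admissible exponent, because x raised to it is the
    identity.\<close>
  have "P (order G)"
    using x fin pow_order_eq_1[OF x] subgroup.one_closed[OF H]
    by (auto simp: P_def order_gt_0_iff_finite)
  then have "P (Least P)" by (rule LeastI)
  moreover have "Least P \<le> k" if "P k" for k using that by (rule Least_le)
  ultimately show ?thesis unfolding P_def by (intro that) auto
qed

text \<open>Induction on the number of elements outside H: each adjunction strictly enlarges the
  subgroup.\<close>

lemma extend_character:
  assumes fin: "finite (carrier G)" and H: "subgroup H G" and chi: "multiplicative_on G H chi"
  shows "\<exists>chi'. multiplicative_on G (carrier G) chi' \<and> (\<forall>h\<in>H. chi' h = chi h)"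
  using H chi
proof (induction "card (carrier G) - card H" arbitrary: H chi rule: less_induct)
  case less
  show ?case
  proof (cases "H = carrier G")
    case True
    then show ?thesis using less.prems by blast
  next
    case False
    have sub: "H \<subseteq> carrier G" using less.prems(1) by (simp add: subgroup.subset)
    then obtain x where x: "x \<in> carrier G" "x \<notin> H" using False by blast
    obtain n :: nat where n: "n > 0" "x [^] n \<in> H" "\<And>k::nat. 0 < k \<Longrightarrow> x [^] k \<in> H \<Longrightarrow> n \<le> k"
      using least_power_in_subgroup[OF fin less.prems(1) x(1)] by blast
    \<comment> \<open>An explicit n-th root; the logarithm is legitimate because a character never
      vanishes.\<close>
    have "exp (Ln (chi (x [^] n)) / of_nat n) ^ n = chi (x [^] n)"
      using n(1) multiplicative_on_inv(1)[OF less.prems(2,1) n(2)]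
      by (simp flip: exp_of_nat_mult)
    then obtain z where z: "z ^ n = chi (x [^] n)" by blast
    obtain H' chi' where H': "subgroup H' G" "H \<subseteq> H'" "x \<in> H'" "multiplicative_on G H' chi'"
      "\<And>h. h \<in> H \<Longrightarrow> chi' h = chi h"
      using extend_character_step[OF less.prems x(1) n z] by metis
    have sub': "H' \<subseteq> carrier G" using H'(1) by (rule subgroup.subset)
    have "card H < card H'"
      using x(2) H'(2,3) by (intro psubset_card_mono finite_subset[OF sub' fin]) auto
    moreover have "card H' \<le> card (carrier G)" using sub' fin by (rule card_mono[rotated])
    ultimately have "card (carrier G) - card H' < card (carrier G) - card H" by simp
    from less.hyps[OF this H'(1,4)] show ?thesis using H'(2,5) by (metis subsetD)
  qed
qed

text \<open>Start from the trivial character of the trivial subgroup: the least exponent is then the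
  order n > 1 of x, so an n-th root of unity other than 1 can be prescribed at x and the result
  extended to the whole group.\<close>

lemma separating_character:
  assumes fin: "finite (carrier G)" and x: "x \<in> carrier G" "x \<noteq> \<one>"
  shows "\<exists>chi\<in>characters G. chi x \<noteq> 1"
proof -
  have H: "subgroup {\<one>} G" by (rule triv_subgroup)
  have c: "multiplicative_on G {\<one>} (\<lambda>_. 1)" by (simp add: multiplicative_on_def)
  obtain n :: nat where n: "n > 0" "x [^] n \<in> {\<one>}" "\<And>k::nat. 0 < k \<Longrightarrow> x [^] k \<in> {\<one>} \<Longrightarrow> n \<le> k"
    using least_power_in_subgroup[OF fin H x(1)] by blast
  have "n \<noteq> 1" using n(2) x by auto
  then have n2: "n > 1" using n(1) by simp
  obtain z :: complex where z: "z ^ n = 1" "z \<noteq> 1"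
  proof -
    have "card {z::complex. z ^ n = 1} = n" using n(1) by (simp add: card_roots_unity_eq)
    then have "\<not> {z::complex. z ^ n = 1} \<subseteq> {1}"
      using n2 card_mono[of "{1::complex}" "{z. z ^ n = 1}"] by auto
    then show ?thesis using that by blast
  qed
  obtain H' chi' where H': "subgroup H' G" "x \<in> H'" "multiplicative_on G H' chi'" "chi' x = z"
    using extend_character_step[OF H c x(1) n, of z] z by metis
  obtain chi where chi: "multiplicative_on G (carrier G) chi" "\<forall>h\<in>H'. chi h = chi' h"
    using extend_character[OF fin H'(1,3)] by blast
  have "restrict chi (carrier G) \<in> characters G"
    using chi(1) by (auto simp: characters_def multiplicative_on_def)
  moreover have "restrict chi (carrier G) x \<noteq> 1" using chi(2) H' x z by simp
  ultimately show ?thesis by blast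
qed

section \<open>Finiteness and orthogonality of characters\<close>

lemma multiplicative_on_character:
  "chi \<in> characters G \<Longrightarrow> multiplicative_on G (carrier G) chi"
  by (simp add: characters_def multiplicative_on_def)

lemma trivial_character_in_characters: "trivial_character G \<in> characters G"
  by (auto simp: trivial_character_def characters_def)

text \<open>All values are roots of unity with exponent the group order, so the characters lie in a
  finite space of extensional functions.\<close>

lemma finite_characters:
  assumes fin: "finite (carrier G)"
  shows "finite (characters G)"
proof -
  have o: "order G > 0" using fin by (simp add: order_gt_0_iff_finite)
  have "chi \<in> carrier G \<rightarrow>\<^sub>E {z. z ^ order G = 1}" if "chi \<in> characters G" for chi
  proof -
    have "chi x ^ order G = 1" if x: "x \<in> carrier G" for x
    proof -
      have "chi \<one> = 1" using \<open>chi \<in> characters G\<close> by (simp add: characters_def)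
      then show ?thesis
        using multiplicative_on_pow[OF multiplicative_on_character[OF \<open>chi \<in> _\<close>] subgroup_self x, of "order G"]
          pow_order_eq_1[OF x] by simp
    qed
    then show ?thesis using that by (auto simp: characters_def)
  qed
  moreover have "finite (carrier G \<rightarrow>\<^sub>E {z::complex. z ^ order G = 1})"
    using fin o by (intro finite_PiE) (auto simp: finite_roots_unity)
  ultimately show ?thesis by (meson finite_subset subsetI)
qed

text \<open>Translating the summation variable by a y with \<open>chi y \<noteq> 1\<close>
  multiplies the sum by \<open>chi y\<close>, which forces it to vanish.\<close>

lemma sum_character:
  assumes chi: "chi \<in> characters G"
  shows "(\<Sum>x\<in>carrier G. chi x) = (if chi = trivial_character G then of_nat (order G) else 0)"
proof (cases "chi = trivial_character G")
  case True
  then show ?thesis by (simp add: trivial_character_def order_def)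
next
  case False
  obtain y where y: "y \<in> carrier G" "chi y \<noteq> 1"
  proof (rule ccontr)
    assume "\<not> thesis"
    then have "\<And>y. y \<in> carrier G \<Longrightarrow> chi y = 1" using that by blast
    then have "chi = trivial_character G"
      using chi by (auto simp: characters_def trivial_character_def PiE_def extensional_def fun_eq_iff)
    then show False using False by simp
  qed
  have "(\<Sum>x\<in>carrier G. chi x) = (\<Sum>x\<in>carrier G. chi (y \<otimes> x))"
    using y(1)
    by (intro sum.reindex_bij_witness[of _ "\<lambda>x. y \<otimes> x" "\<lambda>x. inv y \<otimes> x"])
      (auto simp: m_assoc[symmetric])
  also have "\<dots> = chi y * (\<Sum>x\<in>carrier G. chi x)"
    using chi y(1) by (simp add: characters_def sum_distrib_left)
  finally show ?thesis using y(2) False by (simp add: algebra_simps)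
qed

text \<open>The translation argument on the dual side: multiplication by a character
  \<open>eta\<close> with \<open>eta x \<noteq> 1\<close> permutes the characters and scales the sum
  by \<open>eta x\<close>.\<close>

lemma sum_characters_nontrivial:
  assumes fin: "finite (carrier G)" and x: "x \<in> carrier G" "x \<noteq> \<one>"
  shows "(\<Sum>chi\<in>characters G. chi x) = 0"
proof -
  obtain eta where eta: "eta \<in> characters G" "eta x \<noteq> 1"
    using separating_character[OF assms] by blast
  have eta0: "eta y \<noteq> 0" if "y \<in> carrier G" for y
    using multiplicative_on_inv[OF multiplicative_on_character[OF eta(1)] subgroup_self that] by simp
  have mul: "(\<lambda>y\<in>carrier G. c y * d y) \<in> characters G"
    if "c \<in> characters G" "d \<in> characters G" for c d
    using that by (auto simp: characters_def mult_ac)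
  have inv: "(\<lambda>y\<in>carrier G. inverse (eta y)) \<in> characters G"
    using eta by (auto simp: characters_def mult_ac)
  have "(\<Sum>chi\<in>characters G. chi x) = (\<Sum>chi\<in>characters G. eta x * chi x)"
    using x(1) eta(1) eta0 mul inv
    by (intro sum.reindex_bij_witness[of _ "\<lambda>c. \<lambda>y\<in>carrier G. eta y * c y"
          "\<lambda>c. \<lambda>y\<in>carrier G. (\<lambda>y\<in>carrier G. inverse (eta y)) y * c y"])
      (auto intro!: ext simp: characters_def PiE_def extensional_def restrict_def)
  also have "\<dots> = eta x * (\<Sum>chi\<in>characters G. chi x)" by (simp add: sum_distrib_left)
  finally show ?thesis using eta(2) by (simp add: algebra_simps)
qed

text \<open>In the double sum over elements and characters a single term survives in either order of
  summation: the identity in one, the trivial character in the other.\<close>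

lemma card_characters:
  assumes fin: "finite (carrier G)"
  shows "card (characters G) = order G"
proof -
  have "(\<Sum>x\<in>carrier G. \<Sum>chi\<in>characters G. chi x) = (\<Sum>x\<in>carrier G. if x = \<one> then of_nat (card (characters G)) else 0)"
    using sum_characters_nontrivial[OF fin] by (intro sum.cong) (auto simp: characters_def)
  also have "\<dots> = of_nat (card (characters G))" using fin by simp
  finally have 1: "(\<Sum>x\<in>carrier G. \<Sum>chi\<in>characters G. chi x) = of_nat (card (characters G))" .
  have "(\<Sum>chi\<in>characters G. \<Sum>x\<in>carrier G. chi x)
      = (\<Sum>chi\<in>characters G. if chi = trivial_character G then of_nat (order G) else 0)"
    using sum_character by (intro sum.cong) auto
  also have "\<dots> = of_nat (order G)"
    using finite_characters[OF fin] trivial_character_in_characters by simp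
  finally have "of_nat (order G) = (of_nat (card (characters G)) :: complex)"
    using 1 sum.swap[of "\<lambda>x chi. chi x" "characters G" "carrier G"] by simp
  then show ?thesis by (metis of_nat_eq_iff)
qed

lemma sum_characters:
  assumes fin: "finite (carrier G)" and x: "x \<in> carrier G"
  shows "(\<Sum>chi\<in>characters G. chi x) = (if x = \<one> then of_nat (order G) else 0)"
  using sum_characters_nontrivial[OF assms] card_characters[OF fin]
  by (auto simp: characters_def)

end

section \<open>Two-by-two matrices over residue rings\<close>

lemma red_red: "d dvd n \<Longrightarrow> red d (red n A) = red d A"
  by (cases A) (simp add: mod_mod_cancel)

lemma red_mmul_red: "mmul n (red n A) (red n B) = mmul n A B"
proof -
  have "(a mod int n * (b mod int n) + c mod int n * (d mod int n)) mod int n = (a * b + c * d) mod int n"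
    for a b c d
    by (metis mod_add_eq mod_mult_eq)
  then show ?thesis by (cases A; cases B) simp
qed

lemma red_mmul: "d dvd n \<Longrightarrow> red d (mmul n A B) = mmul d (red d A) (red d B)"
  unfolding red_mmul_red by (cases A; cases B) (simp add: mod_mod_cancel)

lemma red_idem [simp]: "red n (red n A) = red n A"
  by (simp add: red_red)

lemma red_ident: "d dvd n \<Longrightarrow> red d (ident n) = ident d"
  by (simp add: ident_def red_red del: red.simps)

lemma mdet_red: "[mdet (red n A) = mdet A] (mod int n)"
  by (cases A) (auto intro!: cong_diff cong_mult)

lemma coprime_mdet_red: "coprime (mdet (red n A)) (int n) \<longleftrightarrow> coprime (mdet A) (int n)"
  using mdet_red cong_imp_coprime cong_sym by blast

lemma mmul_det: "[mdet (mmul n A B) = mdet A * mdet B] (mod int n)"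
proof (cases A; cases B)
  fix a b c d e f g h assume AB: "A = (a, b, c, d)" "B = (e, f, g, h)"
  have "[mdet (mmul n A B) = mdet (a * e + b * g, a * f + b * h, c * e + d * g, c * f + d * h)] (mod int n)"
    using AB mdet_red by (metis mmul.simps)
  also have "mdet (a * e + b * g, a * f + b * h, c * e + d * g, c * f + d * h) = mdet A * mdet B"
    using AB by (simp add: algebra_simps)
  finally show ?thesis .
qed

lemma red_GL2: "d dvd n \<Longrightarrow> A \<in> GL2 n \<Longrightarrow> red d A \<in> GL2 d"
  by (auto simp: GL2_def coprime_mdet_red intro: coprime_divisors[of "mdet A" "mdet A" "int d" "int n"])

lemma ident_GL2: "ident n \<in> GL2 n"
proof -
  have "coprime (mdet (1, 0, 0, 1)) (int n)" by simp
  then show ?thesis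
    by (simp add: GL2_def ident_def coprime_mdet_red del: red.simps mdet.simps)
qed

lemma mmul_GL2: "A \<in> GL2 n \<Longrightarrow> B \<in> GL2 n \<Longrightarrow> mmul n A B \<in> GL2 n"
proof -
  assume AB: "A \<in> GL2 n" "B \<in> GL2 n"
  have "coprime (mdet A * mdet B) (int n)" using AB by (simp add: GL2_def)
  then have "coprime (mdet (mmul n A B)) (int n)"
    using mmul_det cong_imp_coprime cong_sym by blast
  moreover have "red n (mmul n A B) = mmul n A B"
    using red_mmul[of n n A B] by (simp add: red_mmul_red)
  ultimately show ?thesis by (simp add: GL2_def)
qed

lemma mmul_assoc: "mmul n (mmul n A B) C = mmul n A (mmul n B C)"
proof (cases A; cases B; cases C)
  have left: "mmul n (red n S) T = mmul n S T" and right: "mmul n S (red n T) = mmul n S T" for S T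
    using red_mmul_red red_idem by metis+
  fix a b c d e f g h i j k l
  assume ABC: "A = (a, b, c, d)" "B = (e, f, g, h)" "C = (i, j, k, l)"
  show ?thesis unfolding ABC mmul.simps[of n a] mmul.simps[of n e] left right by (simp add: algebra_simps)
qed

lemma ident_mmul: "A \<in> GL2 n \<Longrightarrow> mmul n (ident n) A = A"
proof -
  assume "A \<in> GL2 n"
  then have A: "red n A = A" by (simp add: GL2_def)
  have "mmul n (red n (1, 0, 0, 1)) (red n A) = red n A"
    unfolding red_mmul_red by (cases A) simp
  then show ?thesis using A by (simp add: ident_def)
qed

lemma mmul_inverse:
  assumes "A \<in> GL2 n"
  shows "\<exists>B\<in>GL2 n. mmul n B A = ident n"
proof -
  obtain a b c d where A: "A = (a, b, c, d)" by (cases A)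
  obtain u where u: "[mdet A * u = 1] (mod int n)"
    using assms cong_solve_coprime_int unfolding GL2_def by blast
  \<comment> \<open>The adjugate of A times an inverse u of the determinant modulo n.\<close>
  define B where "B = (u * d, - (u * b), - (u * c), u * a)"
  have eq: "mmul n B A = red n (mdet A * u, 0, 0, mdet A * u)"
    by (simp add: A B_def algebra_simps)
  have BA: "mmul n B A = ident n" unfolding eq
    using u by (simp add: ident_def cong_def)
  have "coprime (mdet B * mdet A) (int n)"
    using mmul_det[of n B A] ident_GL2[of n] unfolding BA GL2_def
    using cong_imp_coprime by blast
  then have "red n B \<in> GL2 n" by (simp add: GL2_def coprime_mdet_red)
  moreover have "mmul n (red n B) A = ident n"
    using BA red_mmul_red[of n "red n B" A] red_mmul_red[of n B A] assms by (simp add: GL2_def)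
  ultimately show ?thesis by blast
qed

lemma GL2grp_simps [simp]:
  "carrier (GL2grp n) = GL2 n" "x \<otimes>\<^bsub>GL2grp n\<^esub> y = mmul n x y" "\<one>\<^bsub>GL2grp n\<^esub> = ident n"
  by (simp_all add: GL2grp_def)

lemma group_GL2grp: "group (GL2grp n)"
  by (rule groupI)
    (auto simp: mmul_GL2 ident_GL2 ident_mmul mmul_assoc mmul_inverse)

text \<open>Level 1 is the trivial group. This settles splitness with first level 1, and padding
  when the cofactor of a prime power is 1.\<close>

lemma red_1: "red 1 g = ident 1"
  by (cases g) (simp add: ident_def)

lemma red_GL2_id: "g \<in> GL2 n \<Longrightarrow> red n g = g"
  by (simp add: GL2_def)

lemma mmul_ident: "x \<in> GL2 n \<Longrightarrow> mmul n x (ident n) = x"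
  using monoid.r_one[OF group.is_monoid[OF group_GL2grp], of x n] by simp

lemma mmul_right_cancel:
  "mmul n x z = mmul n y z \<Longrightarrow> x \<in> GL2 n \<Longrightarrow> y \<in> GL2 n \<Longrightarrow> z \<in> GL2 n \<Longrightarrow> x = y"
  using group.right_cancel[OF group_GL2grp, of z n x y] by simp

lemma GL2_right_quotient:
  assumes "x \<in> GL2 n" "y \<in> GL2 n"
  shows "\<exists>z\<in>GL2 n. mmul n z y = x"
proof -
  obtain w where w: "w \<in> GL2 n" "mmul n w y = ident n" using mmul_inverse[OF assms(2)] by blast
  have "mmul n (mmul n x w) y = x" by (simp add: mmul_assoc w(2) mmul_ident assms(1))
  then show ?thesis using mmul_GL2[OF assms(1) w(1)] by blast
qed

lemma finite_GL2: "n > 0 \<Longrightarrow> finite (GL2 n)"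
proof -
  assume n: "n > 0"
  have "GL2 n \<subseteq> {0..<int n} \<times> {0..<int n} \<times> {0..<int n} \<times> {0..<int n}"
  proof
    fix A assume "A \<in> GL2 n"
    then have "red n A = A" by (simp add: GL2_def)
    then have "A \<in> red n ` UNIV" by (metis rangeI)
    then show "A \<in> {0..<int n} \<times> {0..<int n} \<times> {0..<int n} \<times> {0..<int n}"
      using n by auto
  qed
  then show ?thesis by (rule finite_subset) auto
qed

section \<open>The Chinese remainder theorem for GL2\<close>

lemma GL2_crt_unique:
  assumes "pairwise (\<lambda>i j. coprime (q i) (q j)) P"
    and "g \<in> GL2 (\<Prod>i\<in>P. q i)" "h \<in> GL2 (\<Prod>i\<in>P. q i)"
    and "\<And>i. i \<in> P \<Longrightarrow> red (q i) g = red (q i) h"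
  shows "g = h"
proof -
  define N where "N = (\<Prod>i\<in>P. q i)"
  have cong: "x mod int N = y mod int N"
    if "\<And>i. i \<in> P \<Longrightarrow> x mod int (q i) = y mod int (q i)" for x y :: int
    using cong_cong_prod_coprime[of P x y "\<lambda>i. int (q i)"] that assms(1)
    by (simp add: cong_def N_def pairwise_def)
  obtain a b c d a' b' c' d' where gh: "g = (a, b, c, d)" "h = (a', b', c', d')"
    by (cases g; cases h)
  have "a mod int (q i) = a' mod int (q i) \<and> b mod int (q i) = b' mod int (q i) \<and>
      c mod int (q i) = c' mod int (q i) \<and> d mod int (q i) = d' mod int (q i)" if "i \<in> P" for i
    using assms(4)[OF that] by (simp add: gh)
  then have "red N g = red N h"
    unfolding gh red.simps prod.inject by (intro conjI cong) blast+
  then show ?thesis using assms(2,3) by (simp add: GL2_def N_def)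
qed

text \<open>Reduced to natural numbers by passing to canonical residues, which are nonnegative
  because the moduli are positive.\<close>

lemma int_chinese_remainder:
  fixes u :: "'a \<Rightarrow> int" and q :: "'a \<Rightarrow> nat"
  assumes "finite P" and "pairwise (\<lambda>i j. coprime (q i) (q j)) P" and "\<And>i. i \<in> P \<Longrightarrow> 0 < q i"
  shows "\<exists>x. \<forall>i\<in>P. x mod int (q i) = u i mod int (q i)"
proof -
  obtain x where x: "\<forall>i\<in>P. [x = nat (u i mod int (q i))] (mod q i)"
    using chinese_remainder_nat[OF assms(1), of q "\<lambda>i. nat (u i mod int (q i))"] assms(2)
    by (auto simp: pairwise_def)
  have "int x mod int (q i) = u i mod int (q i)" if "i \<in> P" for i
  proof -
    have "[int x = int (nat (u i mod int (q i)))] (mod int (q i))"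
      unfolding cong_int_iff using x that by blast
    then show ?thesis using assms(3)[OF that] by (simp add: cong_def)
  qed
  then show ?thesis by blast
qed

text \<open>The four entries are solved for separately; the determinant is a unit modulo the product
  because it is one modulo each factor.\<close>

lemma GL2_crt_exists:
  assumes "finite P" and "pairwise (\<lambda>i j. coprime (q i) (q j)) P" and "\<And>i. i \<in> P \<Longrightarrow> 0 < q i"
    and y: "\<And>i. i \<in> P \<Longrightarrow> y i \<in> GL2 (q i)"
  shows "\<exists>g\<in>GL2 (\<Prod>i\<in>P. q i). \<forall>i\<in>P. red (q i) g = y i"
proof -
  define N where "N = (\<Prod>i\<in>P. q i)"
  have cr: "\<exists>x. \<forall>i\<in>P. x mod int (q i) = u i mod int (q i)" for u
    using int_chinese_remainder[OF assms(1-2)] assms(3) by blast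
  obtain a where a: "\<forall>i\<in>P. a mod int (q i) = fst (y i) mod int (q i)"
    using cr[of "\<lambda>i. fst (y i)"] by blast
  obtain b where b: "\<forall>i\<in>P. b mod int (q i) = fst (snd (y i)) mod int (q i)"
    using cr[of "\<lambda>i. fst (snd (y i))"] by blast
  obtain c where c: "\<forall>i\<in>P. c mod int (q i) = fst (snd (snd (y i))) mod int (q i)"
    using cr[of "\<lambda>i. fst (snd (snd (y i)))"] by blast
  obtain d where d: "\<forall>i\<in>P. d mod int (q i) = snd (snd (snd (y i))) mod int (q i)"
    using cr[of "\<lambda>i. snd (snd (snd (y i)))"] by blast
  define g where "g = (a, b, c, d)"
  have g: "red (q i) g = y i" if "i \<in> P" for i
  proof -
    have "red (q i) g = red (q i) (y i)"
      using a b c d that by (cases "y i") (auto simp: g_def)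
    then show ?thesis using y[OF that] by (simp add: GL2_def)
  qed
  have "coprime (mdet g) (int (q i))" if "i \<in> P" for i
    using g[OF that] y[OF that] coprime_mdet_red[of "q i" g] by (simp add: GL2_def)
  then have "coprime (mdet g) (int N)"
    unfolding N_def of_nat_prod by (rule prod_coprime_right)
  then have "red N g \<in> GL2 N" by (simp add: GL2_def coprime_mdet_red)
  moreover have "red (q i) (red N g) = y i" if "i \<in> P" for i
    using g[OF that] that assms(1) by (simp add: red_red N_def dvd_prodI)
  ultimately show ?thesis unfolding N_def by blast
qed

text \<open>Arbitrary local conditions \<open>T i\<close> are carried along, so that any set cut out
  prime by prime corresponds to the product of its local sets.\<close>

lemma GL2_crt_bij:
  assumes "finite P" and "pairwise (\<lambda>i j. coprime (q i) (q j)) P" and "\<And>i. i \<in> P \<Longrightarrow> 0 < q i"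
    and T: "\<And>i. i \<in> P \<Longrightarrow> T i \<subseteq> GL2 (q i)"
  shows "bij_betw (\<lambda>g. \<lambda>i\<in>P. red (q i) g)
           {g \<in> GL2 (\<Prod>i\<in>P. q i). \<forall>i\<in>P. red (q i) g \<in> T i} (Pi\<^sub>E P T)"
  unfolding bij_betw_def
proof
  show "inj_on (\<lambda>g. \<lambda>i\<in>P. red (q i) g) {g \<in> GL2 (\<Prod>i\<in>P. q i). \<forall>i\<in>P. red (q i) g \<in> T i}"
  proof (rule inj_onI)
    fix g h
    assume g: "g \<in> {g \<in> GL2 (\<Prod>i\<in>P. q i). \<forall>i\<in>P. red (q i) g \<in> T i}"
      and h: "h \<in> {g \<in> GL2 (\<Prod>i\<in>P. q i). \<forall>i\<in>P. red (q i) g \<in> T i}"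
      and eq: "(\<lambda>i\<in>P. red (q i) g) = (\<lambda>i\<in>P. red (q i) h)"
    have "red (q i) g = red (q i) h" if "i \<in> P" for i
      using fun_cong[OF eq, of i] that by simp
    then show "g = h" using g h GL2_crt_unique[OF assms(2)] by blast
  qed
  show "(\<lambda>g. \<lambda>i\<in>P. red (q i) g) ` {g \<in> GL2 (\<Prod>i\<in>P. q i). \<forall>i\<in>P. red (q i) g \<in> T i} = Pi\<^sub>E P T"
    (is "?h ` ?A = _")
  proof
    show "?h ` ?A \<subseteq> Pi\<^sub>E P T" by auto
    show "Pi\<^sub>E P T \<subseteq> ?h ` ?A"
    proof
      fix y assume y: "y \<in> Pi\<^sub>E P T"
      then have yT: "\<And>i. i \<in> P \<Longrightarrow> y i \<in> T i" by auto
      obtain g where g: "g \<in> GL2 (\<Prod>i\<in>P. q i)" "\<forall>i\<in>P. red (q i) g = y i"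
        using GL2_crt_exists[OF assms(1-3), of y] yT T by blast
      then have "?h g = y" using y by (auto simp: PiE_def extensional_def restrict_def)
      moreover have "g \<in> ?A" using g yT by auto
      ultimately show "y \<in> ?h ` ?A" by blast
    qed
  qed
qed

text \<open>The source of every product over primes below. Semiring values cover both uses:
  counting, with F equal to 1, and complex character sums.\<close>

lemma sum_crt:
  fixes F :: "'i \<Rightarrow> m2 \<Rightarrow> 'c :: comm_semiring_1"
  assumes "finite P" and "pairwise (\<lambda>i j. coprime (q i) (q j)) P" and "\<And>i. i \<in> P \<Longrightarrow> 0 < q i"
    and T: "\<And>i. i \<in> P \<Longrightarrow> T i \<subseteq> GL2 (q i)"
  shows "(\<Sum>g\<in>{g \<in> GL2 (\<Prod>i\<in>P. q i). \<forall>i\<in>P. red (q i) g \<in> T i}. \<Prod>i\<in>P. F i (red (q i) g))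
       = (\<Prod>i\<in>P. \<Sum>x\<in>T i. F i x)"
proof -
  have fin: "finite (T i)" if "i \<in> P" for i
    using T[OF that] finite_GL2[OF assms(3)[OF that]] finite_subset by blast
  have "(\<Prod>i\<in>P. \<Sum>x\<in>T i. F i x) = (\<Sum>y\<in>Pi\<^sub>E P T. \<Prod>i\<in>P. F i (y i))"
    using assms(1) fin by (rule prod_sum_PiE)
  also have "\<dots> = (\<Sum>g\<in>{g \<in> GL2 (\<Prod>i\<in>P. q i). \<forall>i\<in>P. red (q i) g \<in> T i}.
      \<Prod>i\<in>P. F i ((\<lambda>i\<in>P. red (q i) g) i))"
    by (rule sum.reindex_bij_betw[symmetric]) (rule GL2_crt_bij[OF assms])
  also have "\<dots> = (\<Sum>g\<in>{g \<in> GL2 (\<Prod>i\<in>P. q i). \<forall>i\<in>P. red (q i) g \<in> T i}. \<Prod>i\<in>P. F i (red (q i) g))"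
    by (intro sum.cong prod.cong) auto
  finally show ?thesis ..
qed

lemma card_crt:
  assumes "finite P" and "pairwise (\<lambda>i j. coprime (q i) (q j)) P" and "\<And>i. i \<in> P \<Longrightarrow> 0 < q i"
    and T: "\<And>i. i \<in> P \<Longrightarrow> T i \<subseteq> GL2 (q i)"
  shows "card {g \<in> GL2 (\<Prod>i\<in>P. q i). \<forall>i\<in>P. red (q i) g \<in> T i} = (\<Prod>i\<in>P. card (T i))"
  using sum_crt[OF assms, of "\<lambda>_ _. 1 :: nat"] by simp

lemma card_crt2:
  assumes "coprime N1 N2" "0 < N1" "0 < N2" "S1 \<subseteq> GL2 N1" "S2 \<subseteq> GL2 N2"
  shows "card {g \<in> GL2 (N1 * N2). red N1 g \<in> S1 \<and> red N2 g \<in> S2} = card S1 * card S2"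
proof -
  \<comment> \<open>Indexing by booleans keeps the two factors apart even when N1 = N2, which
    coprimality permits at 1.\<close>
  define q where "q b = (if b then N1 else N2)" for b
  define T where "T b = (if b then S1 else S2)" for b
  have "card {g \<in> GL2 (\<Prod>b\<in>{True, False}. q b). \<forall>b\<in>{True, False}. red (q b) g \<in> T b} = (\<Prod>b\<in>{True, False}. card (T b))"
    using assms by (intro card_crt) (auto simp: q_def T_def pairwise_def coprime_commute)
  moreover have "\<exists>b::bool. b" "\<exists>b. \<not> b" by blast+
  ultimately show ?thesis
    by (simp add: q_def T_def)
qed

text \<open>The matrices with rows (1, x) and (y, 1 + x y) have determinant 1 and are distinct for
  distinct pairs of residues. Quadratic growth is all that the convergence of the infinite product
  asks for.\<close>

lemma card_GL2_ge:
  assumes "n > 0"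
  shows "n\<^sup>2 \<le> card (GL2 n)"
proof -
  define h where "h p = (case p of (x, y) \<Rightarrow> red n (1, x, y, 1 + x * y))" for p :: "int \<times> int"
  have "inj_on h ({0..<int n} \<times> {0..<int n})"
    by (auto simp: inj_on_def h_def)
  moreover have "h p \<in> GL2 n" for p
  proof (cases p)
    case (Pair x y)
    have "coprime (mdet (1, x, y, 1 + x * y)) (int n)" by simp
    then show ?thesis unfolding GL2_def h_def Pair using coprime_mdet_red red_idem by fastforce
  qed
  then have "h ` ({0..<int n} \<times> {0..<int n}) \<subseteq> GL2 n" by blast
  ultimately have "card ({0..<int n} \<times> {0..<int n}) \<le> card (GL2 n)"
    using finite_GL2[OF assms] card_inj_on_le by blast
  then show ?thesis by (simp add: card_cartesian_product power2_eq_square)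
qed

section \<open>Embedding of the prime-power factors\<close>

abbreviation loc :: "nat \<Rightarrow> nat \<Rightarrow> nat" where
  "loc m l \<equiv> l ^ multiplicity l m"

lemma prod_loc: "m > 0 \<Longrightarrow> (\<Prod>l\<in>prime_factors m. loc m l) = m"
  using prod_prime_factors[of m] by simp

lemma coprime_loc: "pairwise (\<lambda>k l. coprime (loc m k) (loc m l)) (prime_factors m)"
proof (rule pairwiseI)
  fix k l assume "k \<in> prime_factors m" "l \<in> prime_factors m" "k \<noteq> l"
  then have "coprime k l" by (intro primes_coprime) auto
  then show "coprime (loc m k) (loc m l)" by simp
qed

lemma loc_pos: "l \<in> prime_factors m \<Longrightarrow> loc m l > 0"
  by (auto simp: in_prime_factors_iff prime_gt_0_nat)

lemma loc_dvd: "loc m l dvd m"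
  by (rule multiplicity_dvd)

lemma coprime_loc_cofactor:
  assumes "m > 0" "l \<in> prime_factors m"
  shows "coprime (loc m l) (m div loc m l)"
proof -
  have "\<not> l dvd m div loc m l"
    using assms by (intro multiplicity_decompose) (auto simp: in_prime_factors_iff)
  then show ?thesis using assms(2) by (auto simp: in_prime_factors_iff intro: prime_imp_coprime)
qed

lemma loc_mult_cofactor: "loc m l * (m div loc m l) = m"
  using loc_dvd by simp

lemma cofactor_pos:
  assumes "m > (0::nat)"
  shows "m div loc m l > 0"
  using assms loc_mult_cofactor[of l m] by (metis gr0I mult_0_right)

lemma loc_dvd_cofactor:
  assumes "k \<in> prime_factors m" "l \<in> prime_factors m" "k \<noteq> l"
  shows "loc m k dvd m div loc m l"
proof -
  have "coprime (loc m k) (loc m l)" using coprime_loc assms by (auto simp: pairwise_def)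
  moreover have "loc m k dvd loc m l * (m div loc m l)" unfolding loc_mult_cofactor by (rule loc_dvd)
  ultimately show ?thesis by (simp add: coprime_dvd_mult_right_iff)
qed

lemma loc_crt_unique:
  assumes "m > 0" "g \<in> GL2 m" "h \<in> GL2 m"
    and "\<And>l. l \<in> prime_factors m \<Longrightarrow> red (loc m l) g = red (loc m l) h"
  shows "g = h"
  using GL2_crt_unique[OF coprime_loc, of g m h] assms by (simp add: prod_loc)

lemma loc_crt_exists:
  assumes "m > 0" and "\<And>l. l \<in> prime_factors m \<Longrightarrow> y l \<in> GL2 (loc m l)"
  shows "\<exists>g\<in>GL2 m. \<forall>l\<in>prime_factors m. red (loc m l) g = y l"
  using GL2_crt_exists[OF finite_set_mset coprime_loc loc_pos, of m y] assms by (simp add: prod_loc)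

text \<open>Existence and uniqueness come at once from counting: the fibre over two prescribed
  components is a product of singletons. This gives the \<open>THE\<close> in \<open>emb\<close> its
  meaning.\<close>

lemma emb_unique_exists:
  assumes "m > 0" "l \<in> prime_factors m" "x \<in> GL2 (loc m l)"
  shows "\<exists>!g. g \<in> GL2 m \<and> red (loc m l) g = x \<and> red (m div loc m l) g = ident (m div loc m l)"
proof -
  have "card {g \<in> GL2 (loc m l * (m div loc m l)). red (loc m l) g \<in> {x} \<and>
      red (m div loc m l) g \<in> {ident (m div loc m l)}} = card {x} * card {ident (m div loc m l)}"
    using assms coprime_loc_cofactor[OF assms(1,2)] loc_pos cofactor_pos ident_GL2
    by (intro card_crt2) auto
  then have "card {g \<in> GL2 m. red (loc m l) g = x \<and> red (m div loc m l) g = ident (m div loc m l)} = 1"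
    unfolding loc_mult_cofactor by simp
  then obtain g where "{g \<in> GL2 m. red (loc m l) g = x \<and> red (m div loc m l) g = ident (m div loc m l)} = {g}"
    by (auto simp: card_1_singleton_iff)
  then show ?thesis by (intro ex1I[of _ g]) blast+
qed

lemma emb_props:
  assumes "m > 0" "l \<in> prime_factors m" "x \<in> GL2 (loc m l)"
  shows "emb m l x \<in> GL2 m" "red (loc m l) (emb m l x) = x"
    "red (m div loc m l) (emb m l x) = ident (m div loc m l)"
  using theI'[OF emb_unique_exists[OF assms]] unfolding emb_def by blast+

lemma emb_eqI:
  assumes "m > 0" "l \<in> prime_factors m" "g \<in> GL2 m"
    and "red (m div loc m l) g = ident (m div loc m l)"
  shows "emb m l (red (loc m l) g) = g"
proof -
  have "red (loc m l) g \<in> GL2 (loc m l)" using assms(3) by (rule red_GL2[OF loc_dvd])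
  from emb_unique_exists[OF assms(1,2) this] emb_props[OF assms(1,2) this] assms(3,4)
  show ?thesis by blast
qed

lemma red_emb_other:
  assumes "m > 0" "l \<in> prime_factors m" "x \<in> GL2 (loc m l)" "k \<in> prime_factors m" "k \<noteq> l"
  shows "red (loc m k) (emb m l x) = ident (loc m k)"
proof -
  have d: "loc m k dvd m div loc m l" using assms by (intro loc_dvd_cofactor) auto
  have "red (loc m k) (emb m l x) = red (loc m k) (red (m div loc m l) (emb m l x))"
    using d by (simp add: red_red)
  then show ?thesis using emb_props(3)[OF assms(1-3)] d by (simp add: red_ident)
qed

text \<open>One prime is peeled off an element whose components are trivial outside
  \<open>insert l A\<close>. This is the induction step both for membership in a subgroup and for
  the factorisation of a character.\<close>

lemma emb_split:
  assumes m: "m > 0" and g: "g \<in> GL2 m" and l: "l \<in> prime_factors m" "l \<notin> A"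
    and supp: "\<And>k. k \<in> prime_factors m \<Longrightarrow> k \<notin> insert l A \<Longrightarrow> red (loc m k) g = ident (loc m k)"
  obtains g' where "g' \<in> GL2 m" "g = mmul m (emb m l (red (loc m l) g)) g'"
    "\<And>k. k \<in> prime_factors m \<Longrightarrow> red (loc m k) g' = (if k \<in> A then red (loc m k) g else ident (loc m k))"
proof -
  have gk: "red (loc m k) g \<in> GL2 (loc m k)" for k using g by (rule red_GL2[OF loc_dvd])
  obtain g' where g': "g' \<in> GL2 m"
    "\<And>k. k \<in> prime_factors m \<Longrightarrow> red (loc m k) g' = (if k \<in> A then red (loc m k) g else ident (loc m k))"
  proof -
    have "\<exists>g'\<in>GL2 m. \<forall>k\<in>prime_factors m.
        red (loc m k) g' = (if k \<in> A then red (loc m k) g else ident (loc m k))"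
      by (rule loc_crt_exists[OF m]) (simp add: gk ident_GL2)
    then show ?thesis using that by blast
  qed
  note e = emb_props[OF m l(1) gk]
  note unit = ident_mmul mmul_ident
  have "g = mmul m (emb m l (red (loc m l) g)) g'"
  proof (rule loc_crt_unique[OF m g])
    show "mmul m (emb m l (red (loc m l) g)) g' \<in> GL2 m" using e(1) g'(1) by (rule mmul_GL2)
    fix k assume k: "k \<in> prime_factors m"
    have "red (loc m k) (mmul m (emb m l (red (loc m l) g)) g')
        = mmul (loc m k) (red (loc m k) (emb m l (red (loc m l) g))) (red (loc m k) g')"
      by (rule red_mmul[OF loc_dvd])
    also have "\<dots> = red (loc m k) g"
    proof (cases "k = l")
      case True
      then show ?thesis using e(2) g'(2)[OF k] l(2) gk unit by simp
    next
      case False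
      then show ?thesis using red_emb_other[OF m l(1) gk k False] g'(2)[OF k] supp[OF k] gk unit ident_GL2
        by auto
    qed
    finally show "red (loc m k) g = red (loc m k) (mmul m (emb m l (red (loc m l) g)) g')" ..
  qed
  then show ?thesis using that g' by blast
qed

lemma red_group_hom: "d dvd n \<Longrightarrow> group_hom (GL2grp n) (GL2grp d) (red d)"
  by (intro group_hom.intro group_GL2grp group_hom_axioms.intro homI)
    (simp_all add: red_GL2 red_mmul)

text \<open>An element is the product of its padded components, so a subgroup containing these
  contains it. The converse fails in general: the failure is exactly entanglement.\<close>

lemma mem_subgroup_by_emb:
  assumes m: "m > 0" and H: "subgroup H (GL2grp m)"
    and g: "g \<in> GL2 m" "\<And>l. l \<in> prime_factors m \<Longrightarrow> emb m l (red (loc m l) g) \<in> H"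
  shows "g \<in> H"
proof -
  \<comment> \<open>Generalised to elements supported on a set A of primes, to make induction on A
    possible.\<close>
  have "g \<in> H" if "finite A" "A \<subseteq> prime_factors m" "g \<in> GL2 m"
    "\<And>k. k \<in> A \<Longrightarrow> emb m k (red (loc m k) g) \<in> H"
    "\<And>k. k \<in> prime_factors m \<Longrightarrow> k \<notin> A \<Longrightarrow> red (loc m k) g = ident (loc m k)" for A g
    using that
  proof (induction A arbitrary: g rule: finite_induct)
    case empty
    have "g = ident m"
    proof (rule loc_crt_unique[OF m])
      show "red (loc m l) g = red (loc m l) (ident m)" if "l \<in> prime_factors m" for l
        unfolding red_ident[OF loc_dvd] using empty(4) that by blast
    qed (use empty(2) ident_GL2 in simp_all)
    then show ?case using subgroup.one_closed[OF H] by simp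
  next
    case (insert l A)
    obtain g' where g': "g' \<in> GL2 m" "g = mmul m (emb m l (red (loc m l) g)) g'"
      "\<And>k. k \<in> prime_factors m \<Longrightarrow> red (loc m k) g' = (if k \<in> A then red (loc m k) g else ident (loc m k))"
    proof (rule emb_split[OF m insert.prems(2), of l A])
      show "l \<in> prime_factors m" using insert.prems(1) by simp
    qed (use insert.hyps(2) insert.prems(4) in blast)+
    have "g' \<in> H"
    proof (rule insert.IH)
      show "A \<subseteq> prime_factors m" using insert.prems(1) by simp
      show "g' \<in> GL2 m" by fact
      show "emb m k (red (loc m k) g') \<in> H" if "k \<in> A" for k
      proof -
        have "k \<in> prime_factors m" using insert.prems(1) that by blast
        then have "red (loc m k) g' = red (loc m k) g" using g'(3) that by presburger
        then show ?thesis using insert.prems(3)[of k] that by (metis insertI2)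
      qed
      show "red (loc m k) g' = ident (loc m k)" if "k \<in> prime_factors m" "k \<notin> A" for k
        using g'(3) that by presburger
    qed
    moreover have "emb m l (red (loc m l) g) \<in> H" using insert.prems(3) by simp
    ultimately have "mmul m (emb m l (red (loc m l) g)) g' \<in> H"
      using subgroup.m_closed[OF H] unfolding GL2grp_simps by blast
    then show ?case by (subst g'(2))
  qed
  from this[of "prime_factors m" g] show ?thesis using g by blast
qed

section \<open>Compatible systems and the product of the local images\<close>

locale compatible =
  fixes G :: "nat \<Rightarrow> m2 set"
  assumes compat: "compatible_system G"
begin

lemma subgroup_G: "n > 0 \<Longrightarrow> subgroup (G n) (GL2grp n)"
  using compat by (simp add: compatible_system_def)

lemma red_G: "n > 0 \<Longrightarrow> d dvd n \<Longrightarrow> red d ` G n = G d"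
  using compat by (simp add: compatible_system_def)

lemma G_subset: "n > 0 \<Longrightarrow> G n \<subseteq> GL2 n"
  using subgroup.subset[OF subgroup_G] by simp

lemma ident_G: "n > 0 \<Longrightarrow> ident n \<in> G n"
  using subgroup.one_closed[OF subgroup_G] by simp

lemma mmul_G: "n > 0 \<Longrightarrow> x \<in> G n \<Longrightarrow> y \<in> G n \<Longrightarrow> mmul n x y \<in> G n"
  using subgroup.m_closed[OF subgroup_G] by (metis GL2grp_simps(2))

lemma subgroup_calG:
  assumes m: "m > 0"
  shows "subgroup (calG G m) (GL2grp m)"
proof -
  interpret group "GL2grp m" by (rule group_GL2grp)
  show ?thesis
  proof (rule subgroupI)
    show "calG G m \<subseteq> carrier (GL2grp m)" by (auto simp: calG_def)
    have "ident m \<in> calG G m"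
      using ident_G loc_pos by (auto simp: calG_def ident_GL2 red_ident[OF loc_dvd])
    then show "calG G m \<noteq> {}" by blast
    show "inv\<^bsub>GL2grp m\<^esub> a \<in> calG G m" if a: "a \<in> calG G m" for a
    proof -
      have aG: "a \<in> carrier (GL2grp m)" using a by (simp add: calG_def)
      have "red (loc m l) (inv\<^bsub>GL2grp m\<^esub> a) \<in> G (loc m l)" if "l \<in> prime_factors m" for l
        using group_hom.hom_inv[OF red_group_hom[OF loc_dvd] aG]
          subgroup.m_inv_closed[OF subgroup_G[OF loc_pos[OF that]]] a that by (simp add: calG_def)
      moreover have "inv\<^bsub>GL2grp m\<^esub> a \<in> GL2 m" using inv_closed[OF aG] by simp
      ultimately show ?thesis by (simp add: calG_def)
    qed
    show "a \<otimes>\<^bsub>GL2grp m\<^esub> b \<in> calG G m" if "a \<in> calG G m" "b \<in> calG G m" for a b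
      using that mmul_G loc_pos by (auto simp: calG_def mmul_GL2 red_mmul[OF loc_dvd])
  qed
qed

lemma group_calGgrp: "m > 0 \<Longrightarrow> group (calGgrp G m)"
  unfolding calGgrp_def using group.subgroup_imp_group[OF group_GL2grp subgroup_calG] .

lemma calGgrp_simps [simp]:
  "carrier (calGgrp G m) = calG G m" "x \<otimes>\<^bsub>calGgrp G m\<^esub> y = mmul m x y" "\<one>\<^bsub>calGgrp G m\<^esub> = ident m"
  by (simp_all add: calGgrp_def)

lemma finite_calG: "m > 0 \<Longrightarrow> finite (calG G m)"
  using finite_GL2[of m] by (auto simp: calG_def)

lemma G_subset_calG: "m > 0 \<Longrightarrow> G m \<subseteq> calG G m"
  using red_G[OF _ loc_dvd] G_subset unfolding calG_def by blast

lemma emb_calG: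
  assumes "m > 0" "l \<in> prime_factors m" "x \<in> G (loc m l)"
  shows "emb m l x \<in> calG G m"
proof -
  have x: "x \<in> GL2 (loc m l)" using assms G_subset loc_pos by blast
  have "red (loc m k) (emb m l x) \<in> G (loc m k)" if "k \<in> prime_factors m" for k
    using emb_props(2)[OF assms(1,2) x] red_emb_other[OF assms(1,2) x that] assms(3) ident_G loc_pos[OF that]
    by (cases "k = l") auto
  then show ?thesis using emb_props(1)[OF assms(1,2) x] by (simp add: calG_def)
qed

text \<open>A character of the product group is the product of its restrictions to the factors. In
  the induction the remaining factor stays in the product group because each of its components is
  trivial or a component of g.\<close>

lemma multiplicative_on_emb:
  assumes m: "m > 0" and eta: "multiplicative_on (calGgrp G m) (calG G m) eta" and g: "g \<in> calG G m"
  shows "eta g = (\<Prod>l\<in>prime_factors m. eta (emb m l (red (loc m l) g)))"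
proof -
  have "eta g = (\<Prod>l\<in>A. eta (emb m l (red (loc m l) g)))"
    if "finite A" "A \<subseteq> prime_factors m" "g \<in> calG G m"
    "\<And>k. k \<in> prime_factors m \<Longrightarrow> k \<notin> A \<Longrightarrow> red (loc m k) g = ident (loc m k)" for A g
    using that
  proof (induction A arbitrary: g rule: finite_induct)
    case empty
    have gG: "g \<in> GL2 m" using empty(2) by (simp add: calG_def)
    have "g = ident m"
    proof (rule loc_crt_unique[OF m])
      show "red (loc m l) g = red (loc m l) (ident m)" if "l \<in> prime_factors m" for l
        unfolding red_ident[OF loc_dvd] using empty(3) that by blast
    qed (use gG ident_GL2 in simp_all)
    then show ?case using eta by (simp add: multiplicative_on_def)
  next
    case (insert l A)
    have l: "l \<in> prime_factors m" using insert.prems(1) by simp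
    have gG: "g \<in> GL2 m" using insert.prems(2) by (simp add: calG_def)
    obtain g' where g': "g' \<in> GL2 m" "g = mmul m (emb m l (red (loc m l) g)) g'"
      "\<And>k. k \<in> prime_factors m \<Longrightarrow> red (loc m k) g' = (if k \<in> A then red (loc m k) g else ident (loc m k))"
      by (rule emb_split[OF m gG l insert.hyps(2)]) (use insert.prems(3) in blast)+
    have g'c: "g' \<in> calG G m"
      using g'(1,3) insert.prems(2) ident_G loc_pos by (simp add: calG_def)
    have "eta g' = (\<Prod>l\<in>A. eta (emb m l (red (loc m l) g')))"
    proof (rule insert.IH)
      show "red (loc m k) g' = ident (loc m k)" if "k \<in> prime_factors m" "k \<notin> A" for k
        using g'(3) that by presburger
    qed (use insert.prems(1) g'c in blast)+
    also have "\<dots> = (\<Prod>l\<in>A. eta (emb m l (red (loc m l) g)))"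
    proof (rule prod.cong)
      fix k assume "k \<in> A"
      then have "red (loc m k) g' = red (loc m k) g"
        using insert.prems(1) g'(3)[of k] by (metis insert_subset subsetD)
      then show "eta (emb m k (red (loc m k) g')) = eta (emb m k (red (loc m k) g))" by simp
    qed simp
    finally have IH: "eta g' = (\<Prod>l\<in>A. eta (emb m l (red (loc m l) g)))" .
    have "emb m l (red (loc m l) g) \<in> calG G m"
      using m l insert.prems(2) by (intro emb_calG) (auto simp: calG_def)
    then have "eta (mmul m (emb m l (red (loc m l) g)) g') = eta (emb m l (red (loc m l) g)) * eta g'"
      using eta g'c by (simp add: multiplicative_on_def)
    then have "eta g = eta (emb m l (red (loc m l) g)) * eta g'" by (subst g'(2))
    then show ?case using IH insert.hyps by simp
  qed
  from this[of "prime_factors m" g] show ?thesis using g by blast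
qed

end

section \<open>Commutators\<close>

context compatible
begin

text \<open>For the partition into l and the other primes, the Goursat kernel \<open>NA\<close>
  consists of the local elements whose padding by 1 lies in \<open>G M\<close>. Commuting cosets
  only give u v = n1 v n2 u with n1 and n2 in \<open>NA\<close>; what remains is to move n2 to the
  left of v.\<close>

lemma local_commutator_goursat:
  assumes M: "M = mE G" "M > 0" and ae: "abelian_entanglements G"
    and l: "l \<in> prime_factors M" and ne: "prime_factors M - {l} \<noteq> {}"
    and u: "u \<in> G (loc M l)" and v: "v \<in> G (loc M l)"
  shows "\<exists>n\<in>GL2 (loc M l). emb M l n \<in> G M \<and> mmul (loc M l) u v = mmul (loc M l) n (mmul (loc M l) v u)"
proof -
  define nA where "nA = loc M l"
  define nB where "nB = M div loc M l"
  have pA: "ppart M {l} = nA" by (simp add: ppart_def nA_def)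
  \<comment> \<open>The product of the other prime powers is the cofactor in \<open>emb\<close>, so
    triviality on the second block means padding by 1.\<close>
  have "nA * ppart M (prime_factors M - {l}) = M"
    using prod.remove[OF finite_set_mset l, of "loc M"] prod_loc[OF M(2)]
    by (simp add: ppart_def nA_def)
  then have pB: "ppart M (prime_factors M - {l}) = nB"
    using loc_pos[OF l] unfolding nB_def nA_def by (metis nonzero_mult_div_cancel_left not_less_zero)
  have dA: "nA dvd M" by (simp add: nA_def loc_dvd)
  have dB: "nB dvd M" unfolding nB_def using loc_mult_cofactor[of l M] by (metis dvd_triv_right)
  define HA where "HA = red nA ` G M"
  have HA: "HA = G nA" unfolding HA_def by (rule red_G[OF M(2) dA])
  define NA where "NA = {x \<in> HA. \<exists>h\<in>G M. red nA h = x \<and> red nB h = ident nB}"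
  define K where "K = (GL2grp nA)\<lparr>carrier := HA\<rparr>"
  have Ks: "carrier K = HA" "x \<otimes>\<^bsub>K\<^esub> y = mmul nA x y" for x y by (simp_all add: K_def)
  have "comm_group (K Mod NA)"
  proof -
    have "{l} \<union> (prime_factors M - {l}) = prime_factors M" using l by blast
    then show ?thesis
      using ae ne unfolding abelian_entanglements_def Let_def M(1)[symmetric] NA_def HA_def K_def
        pA[symmetric] pB[symmetric] by blast
  qed
  then have comm: "c1 <#>\<^bsub>K\<^esub> c2 = c2 <#>\<^bsub>K\<^esub> c1" if "c1 \<in> carrier (K Mod NA)" "c2 \<in> carrier (K Mod NA)" for c1 c2
    using comm_monoid.m_comm[OF comm_group.axioms(1), of "K Mod NA" c1 c2] that by simp
  have uv: "u \<in> HA" "v \<in> HA" using u v by (simp_all add: HA nA_def)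
  have uvG: "u \<in> GL2 nA" "v \<in> GL2 nA"
    using u v G_subset[OF loc_pos[OF l]] by (auto simp: nA_def)
  have one: "ident nA \<in> NA"
    using ident_G[OF M(2)] red_ident[OF dA] red_ident[OF dB] unfolding NA_def HA_def by force
  have "(NA #>\<^bsub>K\<^esub> u) <#>\<^bsub>K\<^esub> (NA #>\<^bsub>K\<^esub> v) = (NA #>\<^bsub>K\<^esub> v) <#>\<^bsub>K\<^esub> (NA #>\<^bsub>K\<^esub> u)"
    by (rule comm) (use uv in \<open>auto simp: carrier_FactGroup Ks\<close>)
  moreover have "mmul nA u v \<in> (NA #>\<^bsub>K\<^esub> u) <#>\<^bsub>K\<^esub> (NA #>\<^bsub>K\<^esub> v)"
  proof -
    have "w \<in> NA #>\<^bsub>K\<^esub> w" if "w \<in> GL2 nA" for w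
      using one ident_mmul[OF that] unfolding r_coset_def Ks by force
    then show ?thesis using uvG unfolding set_mult_def Ks by blast
  qed
  ultimately obtain n1 n2 where n: "n1 \<in> NA" "n2 \<in> NA"
    "mmul nA u v = mmul nA (mmul nA n1 v) (mmul nA n2 u)"
    unfolding set_mult_def r_coset_def Ks by blast
  obtain h1 h2 where h: "h1 \<in> G M" "red nA h1 = n1" "red nB h1 = ident nB"
    "h2 \<in> G M" "red nA h2 = n2" "red nB h2 = ident nB"
    using n(1,2) unfolding NA_def by blast
  obtain v' where v': "v' \<in> G M" "red nA v' = v" using uv(2) unfolding HA_def by blast
  interpret GM: group "GL2grp M" by (rule group_GL2grp)
  have c: "h1 \<in> GL2 M" "h2 \<in> GL2 M" "v' \<in> GL2 M" using h v' G_subset[OF M(2)] by auto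
  define w where "w = inv\<^bsub>GL2grp M\<^esub> v'"
  have w: "w \<in> G M" "w \<in> GL2 M" "mmul M w v' = ident M"
    using subgroup.m_inv_closed[OF subgroup_G[OF M(2)] v'(1)] GM.inv_closed[of v'] GM.l_inv[of v'] c
    by (simp_all add: w_def)
  \<comment> \<open>k is h1 times the conjugate of h2 by v'. At l it becomes n1 v n2 v^-1, the
    quotient of u v by v u; away from l it is trivial, because h1 and h2 are and v' cancels.\<close>
  define k where "k = mmul M (mmul M (mmul M h1 v') h2) w"
  have kG: "k \<in> G M" unfolding k_def using h v' w by (intro mmul_G[OF M(2)])
  then have kGL: "k \<in> GL2 M" using G_subset[OF M(2)] by blast
  have "mmul M k v' = mmul M (mmul M (mmul M h1 v') h2) (ident M)"
    by (simp add: k_def mmul_assoc w(3))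
  also have "\<dots> = mmul M (mmul M h1 v') h2"
    using c by (simp add: mmul_GL2 mmul_ident)
  finally have kv: "mmul M k v' = mmul M (mmul M h1 v') h2" .
  have "mmul nA (red nA k) v = red nA (mmul M k v')" using v' by (simp add: red_mmul[OF dA])
  also have "\<dots> = mmul nA (mmul nA n1 v) n2" unfolding kv using h v' by (simp add: red_mmul[OF dA])
  finally have "mmul nA u v = mmul nA (red nA k) (mmul nA v u)"
    unfolding n(3) by (metis mmul_assoc)
  moreover have "red nB k = ident nB"
  proof -
    have vB: "red nB v' \<in> GL2 nB" using c red_GL2[OF dB] by simp
    have "mmul nB (red nB k) (red nB v') = red nB (mmul M k v')" by (simp add: red_mmul[OF dB])
    also have "\<dots> = mmul nB (mmul nB (ident nB) (red nB v')) (ident nB)"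
      unfolding kv using h by (simp add: red_mmul[OF dB])
    also have "\<dots> = red nB v'"
      using vB by (simp add: ident_mmul mmul_ident)
    also have "\<dots> = mmul nB (ident nB) (red nB v')" using vB by (simp add: ident_mmul)
    finally show ?thesis
      by (rule mmul_right_cancel[OF _ red_GL2[OF dB kGL] ident_GL2 vB])
  qed
  then have "emb M l (red nA k) = k"
    unfolding nA_def nB_def by (rule emb_eqI[OF M(2) l kGL])
  ultimately show ?thesis
    using kG red_GL2[OF dA kGL] unfolding nA_def by metis
qed

text \<open>A power of a single prime admits no partition into nonempty blocks and is treated
  separately: padding changes nothing there, and \<open>G M\<close> contains its own
  commutators.\<close>

lemma local_commutator:
  assumes M: "M = mE G" "M > 0" and ae: "abelian_entanglements G"
    and l: "l \<in> prime_factors M"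
    and u: "u \<in> G (loc M l)" and v: "v \<in> G (loc M l)"
  shows "\<exists>n\<in>GL2 (loc M l). emb M l n \<in> G M \<and> mmul (loc M l) u v = mmul (loc M l) n (mmul (loc M l) v u)"
proof (cases "prime_factors M - {l} = {}")
  case False
  then show ?thesis using local_commutator_goursat[OF M ae l _ u v] by blast
next
  case True
  then have "prime_factors M = {l}" using l by blast
  then have q: "loc M l = M" using prod_loc[OF M(2)] by simp
  interpret GM: group "GL2grp M" by (rule group_GL2grp)
  have c: "u \<in> GL2 M" "v \<in> GL2 M" using u v G_subset[OF M(2)] unfolding q by auto
  define w where "w = inv\<^bsub>GL2grp M\<^esub> (mmul M v u)"
  define n where "n = mmul M (mmul M u v) w"
  have vu: "mmul M v u \<in> G M" using mmul_G[OF M(2)] u v unfolding q by blast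
  have w: "w \<in> G M" "mmul M w (mmul M v u) = ident M"
    using subgroup.m_inv_closed[OF subgroup_G[OF M(2)] vu] GM.l_inv[of "mmul M v u"] mmul_GL2[OF c(2,1)]
    by (simp_all add: w_def)
  have n: "n \<in> G M" unfolding n_def using u v w(1) mmul_G[OF M(2)] unfolding q by blast
  then have nGL: "n \<in> GL2 M" using G_subset[OF M(2)] by blast
  have "mmul M n (mmul M v u) = mmul M (mmul M u v) (ident M)"
    unfolding n_def mmul_assoc[of M "mmul M u v"] w(2) ..
  also have "\<dots> = mmul M u v" using mmul_GL2[OF c] by (rule mmul_ident)
  finally have "mmul M u v = mmul M n (mmul M v u)" ..
  moreover have "emb M l n = n"
    using emb_eqI[OF M(2) l nGL] M(2) red_1 red_GL2_id[OF nGL] by (simp add: q)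
  ultimately show ?thesis using n nGL unfolding q by metis
qed

text \<open>The solution z of z (y x) = x y has the local commutators as components. Their paddings
  lie in \<open>G M\<close>, hence so does z.\<close>

lemma mE_commutator:
  assumes M: "M = mE G" "M > 0" and ae: "abelian_entanglements G"
    and x: "x \<in> calG G M" and y: "y \<in> calG G M"
  shows "\<exists>h\<in>G M. mmul M x y = mmul M h (mmul M y x)"
proof -
  have c: "x \<in> GL2 M" "y \<in> GL2 M" using x y by (simp_all add: calG_def)
  have cc: "mmul M x y \<in> GL2 M" "mmul M y x \<in> GL2 M" using c mmul_GL2 by blast+
  obtain z where zGL: "z \<in> GL2 M" and z: "mmul M z (mmul M y x) = mmul M x y"
    using GL2_right_quotient[OF cc] by blast
  have "z \<in> G M"
  proof (rule mem_subgroup_by_emb[OF M(2) subgroup_G[OF M(2)] zGL])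
    fix l assume l: "l \<in> prime_factors M"
    have xl: "red (loc M l) x \<in> G (loc M l)" "red (loc M l) y \<in> G (loc M l)"
      using x y l by (simp_all add: calG_def)
    obtain n where n: "n \<in> GL2 (loc M l)" "emb M l n \<in> G M"
      "mmul (loc M l) (red (loc M l) x) (red (loc M l) y)
       = mmul (loc M l) n (mmul (loc M l) (red (loc M l) y) (red (loc M l) x))"
      using local_commutator[OF M ae l xl] by blast
    have "mmul (loc M l) (red (loc M l) z) (red (loc M l) (mmul M y x))
        = mmul (loc M l) n (red (loc M l) (mmul M y x))"
      using arg_cong[OF z, of "red (loc M l)"] n(3) by (simp add: red_mmul[OF loc_dvd])
    then have "red (loc M l) z = n"
      by (rule mmul_right_cancel[OF _ red_GL2[OF loc_dvd zGL] n(1) red_GL2[OF loc_dvd cc(2)]])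
    then show "emb M l (red (loc M l) z) \<in> G M" using n(2) by simp
  qed
  then show ?thesis using z by metis
qed

section \<open>Passing between levels with the same primes\<close>

lemma calG_lift:
  assumes N: "N > 0" "m dvd N" "prime_factors N = prime_factors m" and x: "x \<in> calG G m"
  shows "\<exists>x'\<in>calG G N. red m x' = x"
proof -
  have m: "m > 0" using N by (meson dvd_pos_nat)
  have d: "loc m l dvd loc N l" for l
    using N by (intro le_imp_power_dvd dvd_imp_multiplicity_le) auto
  have "\<exists>y. y \<in> G (loc N l) \<and> red (loc m l) y = red (loc m l) x" if l: "l \<in> prime_factors N" for l
  proof -
    have "red (loc m l) x \<in> G (loc m l)" using x l N(3) by (simp add: calG_def)
    also have "G (loc m l) = red (loc m l) ` G (loc N l)" using red_G[OF loc_pos[OF l] d] by simp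
    finally show ?thesis by (metis (no_types, lifting) imageE)
  qed
  then obtain y where y: "\<And>l. l \<in> prime_factors N \<Longrightarrow> y l \<in> G (loc N l) \<and> red (loc m l) (y l) = red (loc m l) x"
    by metis
  have "y l \<in> GL2 (loc N l)" if "l \<in> prime_factors N" for l
    using y[OF that] G_subset[OF loc_pos[OF that]] by blast
  then obtain x' where x': "x' \<in> GL2 N" "\<forall>l\<in>prime_factors N. red (loc N l) x' = y l"
    using loc_crt_exists[OF N(1), of y] by blast
  have xc: "x' \<in> calG G N" using x' y by (simp add: calG_def)
  have "red m x' = x"
  proof (rule loc_crt_unique[OF m])
    show "red m x' \<in> GL2 m" using x'(1) by (rule red_GL2[OF N(2)])
    show "x \<in> GL2 m" using x by (simp add: calG_def)
    fix l assume l: "l \<in> prime_factors m"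
    then have l': "l \<in> prime_factors N" using N(3) by simp
    have "red (loc m l) (red m x') = red (loc m l) (red (loc N l) x')"
      by (simp add: red_red[OF loc_dvd] red_red[OF d])
    then show "red (loc m l) (red m x') = red (loc m l) x" using x'(2) y[OF l'] l' by simp
  qed
  then show ?thesis using xc by blast
qed

lemma red_calG:
  assumes N: "N > 0" "m dvd N" "prime_factors N = prime_factors m" and x: "x \<in> calG G N"
  shows "red m x \<in> calG G m"
proof -
  have d: "loc m l dvd loc N l" for l
    using N by (intro le_imp_power_dvd dvd_imp_multiplicity_le) auto
  have "red (loc m l) (red m x) \<in> G (loc m l)" if l: "l \<in> prime_factors m" for l
  proof -
    have l': "l \<in> prime_factors N" using N(3) l by simp
    have "red (loc m l) (red m x) = red (loc m l) (red (loc N l) x)"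
      by (simp add: red_red[OF loc_dvd] red_red[OF d])
    moreover have "red (loc N l) x \<in> G (loc N l)" using x l' by (simp add: calG_def)
    ultimately show ?thesis using red_G[OF loc_pos[OF l'] d] by (metis imageI)
  qed
  then show ?thesis using x red_GL2[OF N(2)] by (simp add: calG_def)
qed

text \<open>The commutator z of lifts to level N reduces into \<open>G M\<close> by the result at
  level M; stability then puts z itself into \<open>G N\<close>, and its reduction to level m is the
  desired element.\<close>

lemma calG_commutator:
  assumes M: "M = mE G" "M > 0" and ae: "abelian_entanglements G" and st: "stable_level G M"
    and m: "m > 0" "prime_factors m = prime_factors M"
    and x: "x \<in> calG G m" and y: "y \<in> calG G m"
  shows "\<exists>h\<in>G m. mmul m x y = mmul m h (mmul m y x)"
proof -
  \<comment> \<open>A common multiple of both levels with no new primes: stability speaks only of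
    multiples of M supported on the primes of M.\<close>
  define N where "N = M * m"
  have N: "N > 0" "m dvd N" "M dvd N" "prime_factors N = prime_factors m" "prime_factors N = prime_factors M"
    using M m by (auto simp: N_def prime_factorization_mult)
  obtain x' where x': "x' \<in> calG G N" "red m x' = x" using calG_lift[OF N(1,2,4) x] by blast
  obtain y' where y': "y' \<in> calG G N" "red m y' = y" using calG_lift[OF N(1,2,4) y] by blast
  have c: "x' \<in> GL2 N" "y' \<in> GL2 N" using x' y' by (simp_all add: calG_def)
  have cc: "mmul N x' y' \<in> GL2 N" "mmul N y' x' \<in> GL2 N" using c mmul_GL2 by blast+
  obtain z where zGL: "z \<in> GL2 N" and z: "mmul N z (mmul N y' x') = mmul N x' y'"
    using GL2_right_quotient[OF cc] by blast
  obtain h where h: "h \<in> G M"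
    "mmul M (red M x') (red M y') = mmul M h (mmul M (red M y') (red M x'))"
    using mE_commutator[OF M ae red_calG[OF N(1,3,5) x'(1)] red_calG[OF N(1,3,5) y'(1)]] by blast
  have "mmul M (red M z) (red M (mmul N y' x')) = mmul M h (red M (mmul N y' x'))"
    using arg_cong[OF z, of "red M"] h(2) by (simp add: red_mmul[OF N(3)])
  then have "red M z = h"
    using mmul_right_cancel[OF _ red_GL2[OF N(3) zGL] _ red_GL2[OF N(3) cc(2)]] h(1) G_subset[OF M(2)]
    by blast
  moreover have "G N = {g \<in> GL2 N. red M g \<in> G M}"
  proof -
    have "\<forall>p. Factorial_Ring.prime p \<longrightarrow> p dvd N \<longrightarrow> p dvd M"
      using N(1,5) by (metis dvd_0_right in_prime_factors_imp_dvd not_less0 prime_factorsI)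
    then show ?thesis using st N(1,3) unfolding stable_level_def by blast
  qed
  ultimately have "z \<in> G N" using zGL h(1) by simp
  then have "red m z \<in> G m" using red_G[OF N(1,2)] by blast
  moreover have "mmul m x y = mmul m (red m z) (mmul m y x)"
    using arg_cong[OF z, of "red m"] x'(2) y'(2) by (simp add: red_mmul[OF N(2)])
  ultimately show ?thesis by blast
qed

end

section \<open>Densities as character sums\<close>

context compatible
begin

text \<open>The relation x h = k h x with k in \<open>G m\<close> says that conjugation by x sends h
  to k h, again in \<open>G m\<close>.\<close>

lemma normal_G_calG:
  assumes m: "m > 0"
    and comm: "\<And>x y. x \<in> calG G m \<Longrightarrow> y \<in> calG G m \<Longrightarrow> \<exists>h\<in>G m. mmul m x y = mmul m h (mmul m y x)"
  shows "normal (G m) (calGgrp G m)"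
proof -
  interpret C: group "calGgrp G m" by (rule group_calGgrp[OF m])
  have sub: "subgroup (G m) (calGgrp G m)"
    unfolding calGgrp_def
    by (rule group.subgroup_incl[OF group_GL2grp subgroup_G[OF m] subgroup_calG[OF m] G_subset_calG[OF m]])
  have "x \<otimes>\<^bsub>calGgrp G m\<^esub> h \<otimes>\<^bsub>calGgrp G m\<^esub> inv\<^bsub>calGgrp G m\<^esub> x \<in> G m"
    if x: "x \<in> carrier (calGgrp G m)" and h: "h \<in> G m" for x h
  proof -
    have hc: "h \<in> carrier (calGgrp G m)" using h sub subgroup.mem_carrier by metis
    obtain k where k: "k \<in> G m" "x \<otimes>\<^bsub>calGgrp G m\<^esub> h = k \<otimes>\<^bsub>calGgrp G m\<^esub> (h \<otimes>\<^bsub>calGgrp G m\<^esub> x)"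
      using comm[of x h] x hc by auto
    have kc: "k \<in> carrier (calGgrp G m)" using k(1) sub subgroup.mem_carrier by metis
    have "x \<otimes>\<^bsub>calGgrp G m\<^esub> h \<otimes>\<^bsub>calGgrp G m\<^esub> inv\<^bsub>calGgrp G m\<^esub> x = k \<otimes>\<^bsub>calGgrp G m\<^esub> h"
      unfolding k(2) using x hc kc
      by (metis C.inv_closed C.m_assoc C.m_closed C.r_inv C.r_one)
    then show ?thesis using subgroup.m_closed[OF sub k(1) h] by simp
  qed
  then show ?thesis using sub C.normal_inv_iff by blast
qed

lemma comm_group_Phi:
  assumes m: "m > 0"
    and comm: "\<And>x y. x \<in> calG G m \<Longrightarrow> y \<in> calG G m \<Longrightarrow> \<exists>h\<in>G m. mmul m x y = mmul m h (mmul m y x)"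
  shows "comm_group (Phi G m)"
proof -
  interpret C: group "calGgrp G m" by (rule group_calGgrp[OF m])
  interpret N: normal "G m" "calGgrp G m" by (rule normal_G_calG[OF assms])
  interpret P: group "Phi G m" unfolding Phi_def by (rule N.factorgroup_is_group)
  show ?thesis
  proof (rule P.group_comm_groupI)
    fix c d assume "c \<in> carrier (Phi G m)" "d \<in> carrier (Phi G m)"
    then obtain x y where x: "x \<in> carrier (calGgrp G m)" "c = G m #>\<^bsub>calGgrp G m\<^esub> x"
      and y: "y \<in> carrier (calGgrp G m)" "d = G m #>\<^bsub>calGgrp G m\<^esub> y"
      unfolding Phi_def carrier_FactGroup by blast
    obtain h where h: "h \<in> G m" "x \<otimes>\<^bsub>calGgrp G m\<^esub> y = h \<otimes>\<^bsub>calGgrp G m\<^esub> (y \<otimes>\<^bsub>calGgrp G m\<^esub> x)"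
      using comm[of x y] x y by auto
    have hc: "h \<in> carrier (calGgrp G m)" using h(1) N.mem_carrier by blast
    have "G m #>\<^bsub>calGgrp G m\<^esub> (x \<otimes>\<^bsub>calGgrp G m\<^esub> y)
        = (G m #>\<^bsub>calGgrp G m\<^esub> h) #>\<^bsub>calGgrp G m\<^esub> (y \<otimes>\<^bsub>calGgrp G m\<^esub> x)"
      unfolding h(2) by (rule C.coset_mult_assoc[symmetric]) (use N.subset hc x y in \<open>blast intro: C.m_closed\<close>)+
    also have "G m #>\<^bsub>calGgrp G m\<^esub> h = G m"
      by (rule C.coset_join2[OF hc N.subgroup_axioms h(1)])
    finally show "c \<otimes>\<^bsub>Phi G m\<^esub> d = d \<otimes>\<^bsub>Phi G m\<^esub> c"
      unfolding Phi_def mult_FactGroup x(2) y(2) using x(1) y(1) by (simp only: N.rcos_sum)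
  qed
qed

text \<open>Pulls a character of the quotient back to the product group, where factorisation over
  the primes applies.\<close>

lemma multiplicative_on_psi:
  assumes N: "normal (G m) (calGgrp G m)" and chi: "chi \<in> characters (Phi G m)"
  shows "multiplicative_on (calGgrp G m) (calG G m) (\<lambda>g. chi (psi G m g))"
proof -
  interpret N: normal "G m" "calGgrp G m" by (rule N)
  have car: "psi G m g \<in> carrier (Phi G m)" if "g \<in> calG G m" for g
    using that unfolding psi_def Phi_def carrier_FactGroup by simp
  have mult: "psi G m (x \<otimes>\<^bsub>calGgrp G m\<^esub> y) = psi G m x \<otimes>\<^bsub>Phi G m\<^esub> psi G m y"
    if "x \<in> calG G m" "y \<in> calG G m" for x y
    unfolding psi_def Phi_def mult_FactGroup using that N.rcos_sum[of x y] by simp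
  have one: "psi G m \<one>\<^bsub>calGgrp G m\<^esub> = \<one>\<^bsub>Phi G m\<^esub>"
    unfolding psi_def Phi_def one_FactGroup by (rule N.coset_mult_one[OF N.subset])
  show ?thesis
    unfolding multiplicative_on_def one using chi car
    by (simp add: mult[unfolded calGgrp_simps] characters_def)
qed

lemma sum_characters_psi:
  assumes m: "m > 0"
    and comm: "\<And>x y. x \<in> calG G m \<Longrightarrow> y \<in> calG G m \<Longrightarrow> \<exists>h\<in>G m. mmul m x y = mmul m h (mmul m y x)"
    and g: "g \<in> calG G m"
  shows "(\<Sum>chi\<in>characters (Phi G m). chi (psi G m g)) = (if g \<in> G m then of_nat (order (Phi G m)) else 0)"
proof -
  interpret N: normal "G m" "calGgrp G m" by (rule normal_G_calG[OF m comm])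
  interpret P: comm_group "Phi G m" by (rule comm_group_Phi[OF m comm])
  have fin: "finite (carrier (Phi G m))"
    unfolding Phi_def carrier_FactGroup using finite_calG[OF m] by simp
  have gc: "g \<in> carrier (calGgrp G m)" using g by simp
  have "psi G m g \<in> carrier (Phi G m)"
    using g unfolding psi_def Phi_def carrier_FactGroup by simp
  moreover have "psi G m g = \<one>\<^bsub>Phi G m\<^esub> \<longleftrightarrow> g \<in> G m"
    unfolding psi_def Phi_def one_FactGroup
    using N.coset_join1[OF _ gc N.subgroup_axioms] N.coset_join2[OF gc N.subgroup_axioms] by blast
  ultimately show ?thesis using P.sum_characters[OF fin] by simp
qed

lemma order_Phi:
  assumes m: "m > 0"
  shows "order (Phi G m) * card (G m) = card (calG G m)"
proof -
  interpret C: group "calGgrp G m" by (rule group_calGgrp[OF m])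
  have "subgroup (G m) (calGgrp G m)"
    unfolding calGgrp_def
    by (rule group.subgroup_incl[OF group_GL2grp subgroup_G[OF m] subgroup_calG[OF m] G_subset_calG[OF m]])
  from C.lagrange[OF this] show ?thesis
    by (simp add: order_def Phi_def FactGroup_def)
qed

text \<open>Both counts are scaled by the order of the quotient group: the numerator becomes a sum
  of character sums, the denominator the order of the full product by Lagrange. Dividing cancels the
  scale and leaves the local proportions.\<close>

lemma density_by_characters:
  fixes T :: "nat \<Rightarrow> m2 set"
  defines "E \<equiv> \<lambda>m chi l. (\<Sum>x\<in>T l. chi (psi G m (emb m l x))) / of_nat (card (T l))"
  assumes m: "m > 0"
    and comm: "\<And>x y. x \<in> calG G m \<Longrightarrow> y \<in> calG G m \<Longrightarrow> \<exists>h\<in>G m. mmul m x y = mmul m h (mmul m y x)"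
    and T: "\<And>l. l \<in> prime_factors m \<Longrightarrow> T l \<subseteq> G (loc m l)"
    and ne: "\<And>l. l \<in> prime_factors m \<Longrightarrow> T l \<noteq> {}"
  shows "complex_of_real (real (card {g \<in> G m. \<forall>l\<in>prime_factors m. red (loc m l) g \<in> T l}) / real (card (G m)))
       = (1 + (\<Sum>chi\<in>characters (Phi G m) - {trivial_character (Phi G m)}. \<Prod>l\<in>prime_factors m. E m chi l))
         * complex_of_real (\<Prod>l\<in>prime_factors m. real (card (T l)) / real (card (G (loc m l))))"
proof -
  interpret P: comm_group "Phi G m" by (rule comm_group_Phi[OF m comm])
  define \<Phi> where "\<Phi> = Phi G m"
  have fin: "finite (carrier \<Phi>)"
    unfolding Phi_def \<Phi>_def carrier_FactGroup using finite_calG[OF m] by simp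
  have TGL: "T l \<subseteq> GL2 (loc m l)" if "l \<in> prime_factors m" for l
    using T[OF that] G_subset[OF loc_pos[OF that]] by blast
  have Tfin: "finite (T l)" if "l \<in> prime_factors m" for l
    using TGL[OF that] finite_GL2[OF loc_pos[OF that]] finite_subset by blast
  have cardT: "card (T l) > 0" if "l \<in> prime_factors m" for l
    using Tfin[OF that] ne[OF that] by (simp add: card_gt_0_iff)
  define B where "B = {g \<in> GL2 m. \<forall>l\<in>prime_factors m. red (loc m l) g \<in> T l}"
  define D where "D = {g \<in> G m. \<forall>l\<in>prime_factors m. red (loc m l) g \<in> T l}"
  have B: "B \<subseteq> calG G m" unfolding B_def calG_def using T by blast
  have finB: "finite B" using finite_subset[OF B finite_calG[OF m]] .
  have DB: "D = {g \<in> B. g \<in> G m}" unfolding D_def B_def using G_subset[OF m] by blast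
  have charsum: "(\<Sum>g\<in>B. chi (psi G m g)) = (\<Prod>l\<in>prime_factors m. of_nat (card (T l))) * (\<Prod>l\<in>prime_factors m. E m chi l)"
    if chi: "chi \<in> characters \<Phi>" for chi
  proof -
    have "(\<Sum>g\<in>B. chi (psi G m g)) = (\<Sum>g\<in>B. \<Prod>l\<in>prime_factors m. chi (psi G m (emb m l (red (loc m l) g))))"
      using multiplicative_on_emb[OF m multiplicative_on_psi[OF normal_G_calG[OF m comm] chi[unfolded \<Phi>_def]]] B
      by (intro sum.cong) blast+
    also have "\<dots> = (\<Prod>l\<in>prime_factors m. \<Sum>x\<in>T l. chi (psi G m (emb m l x)))"
    proof -
      have "(\<Sum>g\<in>{g \<in> GL2 (\<Prod>l\<in>prime_factors m. loc m l). \<forall>l\<in>prime_factors m. red (loc m l) g \<in> T l}.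
            \<Prod>l\<in>prime_factors m. chi (psi G m (emb m l (red (loc m l) g))))
          = (\<Prod>l\<in>prime_factors m. \<Sum>x\<in>T l. chi (psi G m (emb m l x)))"
        by (rule sum_crt[OF finite_set_mset coprime_loc loc_pos TGL])
      then show ?thesis unfolding prod_loc[OF m] B_def .
    qed
    \<comment> \<open>Each local sum is rewritten as the size of \<open>T l\<close> times a mean,
      which is valid because \<open>T l\<close> is nonempty.\<close>
    also have "\<dots> = (\<Prod>l\<in>prime_factors m. of_nat (card (T l)) * E m chi l)"
      using cardT by (intro prod.cong) (auto simp: E_def)
    finally show ?thesis by (simp add: prod.distrib)
  qed
  have "of_nat (order \<Phi>) * of_nat (card D) = (\<Sum>g\<in>B. if g \<in> G m then complex_of_nat (order \<Phi>) else 0)"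
    unfolding DB using finB by (simp add: sum.If_cases Int_def)
  also have "\<dots> = (\<Sum>g\<in>B. \<Sum>chi\<in>characters \<Phi>. chi (psi G m g))"
    using sum_characters_psi[OF m comm] B unfolding \<Phi>_def by (intro sum.cong) auto
  also have "\<dots> = (\<Sum>chi\<in>characters \<Phi>. \<Sum>g\<in>B. chi (psi G m g))" by (rule sum.swap)
  also have "\<dots> = (\<Prod>l\<in>prime_factors m. of_nat (card (T l))) * (\<Sum>chi\<in>characters \<Phi>. \<Prod>l\<in>prime_factors m. E m chi l)"
    using charsum by (simp add: sum_distrib_left)
  also have "(\<Sum>chi\<in>characters \<Phi>. \<Prod>l\<in>prime_factors m. E m chi l)
      = 1 + (\<Sum>chi\<in>characters \<Phi> - {trivial_character \<Phi>}. \<Prod>l\<in>prime_factors m. E m chi l)" (is "_ = 1 + ?R")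
  proof -
    \<comment> \<open>The trivial character has mean 1 at every prime and accounts for the leading 1
      of the correction factor.\<close>
    have "E m (trivial_character \<Phi>) l = 1" if l: "l \<in> prime_factors m" for l
    proof -
      have "trivial_character \<Phi> (psi G m (emb m l x)) = 1" if "x \<in> T l" for x
        using emb_calG[OF m l, of x] T[OF l] that
        unfolding trivial_character_def psi_def \<Phi>_def Phi_def carrier_FactGroup by auto
      then show ?thesis using cardT[OF l] by (simp add: E_def)
    qed
    then show ?thesis
      using P.finite_characters[folded \<Phi>_def, OF fin] P.trivial_character_in_characters[folded \<Phi>_def]
      by (simp add: sum.remove)
  qed
  finally have main: "of_nat (order \<Phi>) * of_nat (card D) = (\<Prod>l\<in>prime_factors m. complex_of_nat (card (T l))) * (1 + ?R)" .
  have "card {g \<in> GL2 (\<Prod>l\<in>prime_factors m. loc m l). \<forall>l\<in>prime_factors m. red (loc m l) g \<in> G (loc m l)}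
      = (\<Prod>l\<in>prime_factors m. card (G (loc m l)))"
    by (rule card_crt[OF finite_set_mset coprime_loc loc_pos G_subset[OF loc_pos]])
  then have "card (calG G m) = (\<Prod>l\<in>prime_factors m. card (G (loc m l)))"
    unfolding prod_loc[OF m] calG_def .
  then have order: "of_nat (order \<Phi>) * complex_of_nat (card (G m)) = (\<Prod>l\<in>prime_factors m. of_nat (card (G (loc m l))))"
    using order_Phi[OF m] unfolding \<Phi>_def by (metis of_nat_mult of_nat_prod)
  have ord0: "order \<Phi> > 0" using P.order_gt_0_iff_finite fin unfolding \<Phi>_def by blast
  have G0: "card (G m) > 0"
    using ident_G[OF m] finite_subset[OF G_subset[OF m] finite_GL2[OF m]] by (auto simp: card_gt_0_iff)
  have "complex_of_nat (card D) / of_nat (card (G m))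
      = (of_nat (order \<Phi>) * of_nat (card D)) / (of_nat (order \<Phi>) * of_nat (card (G m)))"
    using ord0 by simp
  also have "\<dots> = (1 + ?R) * (\<Prod>l\<in>prime_factors m. of_nat (card (T l)) / of_nat (card (G (loc m l))))"
    unfolding main order by (simp add: prod_dividef)
  finally show ?thesis unfolding D_def[symmetric] \<Phi>_def by simp
qed

end

section \<open>The primes outside the split level\<close>

lemma lev_pos: "Factorial_Ring.prime l \<Longrightarrow> lev f l > 0"
  by (simp add: lev_def prime_gt_0_nat)

lemma coprime_lev:
  assumes "\<And>l. l \<in> P \<Longrightarrow> Factorial_Ring.prime l"
  shows "pairwise (\<lambda>k l. coprime (lev f k) (lev f l)) P"
  using assms by (auto simp: pairwise_def lev_def primes_coprime)

lemma lev_dvd: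
  assumes "f > 0" "l dvd f" "Factorial_Ring.prime l"
  shows "lev f l = loc f l"
proof -
  have "multiplicity l f > 0" using assms by (simp add: prime_multiplicity_gt_zero_iff)
  then have "max (multiplicity l f) 1 = multiplicity l f" by simp
  then show ?thesis by (simp add: lev_def)
qed

lemma lev_not_dvd: "\<not> l dvd f \<Longrightarrow> lev f l = l"
  by (simp add: lev_def not_dvd_imp_multiplicity_0)

text \<open>The two products merge because \<open>lev f l\<close> is the full power of l in f if l
  divides f, and l otherwise. Thus m carries at each of its primes the level on which
  \<open>Sset\<close> lives.\<close>

lemma mlev_eq:
  assumes "f > 0"
  shows "mlev G f = (\<Prod>l\<in>prime_factors (mE G). lev f l)"
proof -
  let ?P = "prime_factors (mE G)"
  have "(\<Prod>l\<in>?P. lev f l) = (\<Prod>l\<in>{l \<in> ?P. l dvd f} \<union> {l \<in> ?P. \<not> l dvd f}. lev f l)"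
    by (intro prod.cong) auto
  also have "\<dots> = (\<Prod>l\<in>{l \<in> ?P. l dvd f}. lev f l) * (\<Prod>l\<in>{l \<in> ?P. \<not> l dvd f}. lev f l)"
    by (rule prod.union_disjoint) auto
  also have "(\<Prod>l\<in>{l \<in> ?P. l dvd f}. lev f l) = (\<Prod>l\<in>{l \<in> ?P. l dvd f}. loc f l)"
    using assms by (intro prod.cong refl lev_dvd) auto
  also have "(\<Prod>l\<in>{l \<in> ?P. \<not> l dvd f}. lev f l) = (\<Prod>l\<in>{l \<in> ?P. \<not> l dvd f}. l)"
    by (intro prod.cong refl lev_not_dvd) auto
  finally show ?thesis by (simp add: mlev_def)
qed

lemma mlev_pos: "f > 0 \<Longrightarrow> mlev G f > 0"
  unfolding mlev_eq by (intro prod_pos) (auto intro: lev_pos)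

lemma multiplicity_mlev:
  assumes "f > 0" "Factorial_Ring.prime l"
  shows "multiplicity l (mlev G f) = (if l \<in> prime_factors (mE G) then max (multiplicity l f) 1 else 0)"
  unfolding mlev_eq[OF assms(1)] lev_def
  by (rule multiplicity_prod_prime_powers) (auto simp: assms(2))

lemma prime_factors_mlev:
  assumes "f > 0"
  shows "prime_factors (mlev G f) = prime_factors (mE G)"
proof -
  have "0 < multiplicity l (mlev G f) \<longleftrightarrow> l \<in> prime_factors (mE G)" if "Factorial_Ring.prime l" for l
    using multiplicity_mlev[OF assms that, of G] by (simp add: less_max_iff_disj)
  then show ?thesis unfolding prime_factors_multiplicity[of "mlev G f"] by blast
qed

lemma loc_mlev:
  assumes "f > 0" "l \<in> prime_factors (mE G)"
  shows "loc (mlev G f) l = lev f l"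
proof -
  have "Factorial_Ring.prime l" using assms(2) by auto
  then show ?thesis using multiplicity_mlev[OF assms(1)] assms(2) by (simp add: lev_def)
qed

lemma mE_split_stable:
  assumes "\<exists>n>0. split_level G n \<and> stable_level G n"
  shows "mE G > 0" "split_level G (mE G)" "stable_level G (mE G)"
  using LeastI_ex[of "\<lambda>n. 0 < n \<and> split_level G n \<and> stable_level G n"] assms
  unfolding mE_def by blast+

lemma Sset_subset:
  assumes "f > 0" "Factorial_Ring.prime l"
  shows "Sset G f a l \<subseteq> G (lev f l)"
proof (cases "l dvd f")
  case True
  then show ?thesis using lev_dvd[OF assms(1) True assms(2)] by (auto simp: Sset_def)
next
  case False
  then show ?thesis using lev_not_dvd[OF False] by (auto simp: Sset_def)
qed

context compatible
begin

text \<open>Splitness with first level 1, where the remaining condition is void.\<close>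

lemma G_eq_GL2:
  assumes "split_level G n" "coprime N n" "N > 0"
  shows "G N = GL2 N"
proof -
  have "\<forall>p. Factorial_Ring.prime p \<longrightarrow> p dvd 1 \<longrightarrow> p dvd n" by auto
  then have "G (1 * N) = {g \<in> GL2 (1 * N). red 1 g \<in> G 1}"
    using assms less_one unfolding split_level_def by blast
  moreover have "red 1 g \<in> G 1" for g
    unfolding red_1 by (rule ident_G) simp
  ultimately show ?thesis by simp
qed

text \<open>Splitness is applied with first factor m instead of M, as it only asks that the primes
  of that factor divide M. The conditions at primes of m and at all other primes then fall on
  independent factors.\<close>

lemma dens_eq:
  assumes f: "f > 0" and M: "mE G > 0" and sp: "split_level G (mE G)" and x: "mE G \<le> x"
  defines "m \<equiv> mlev G f"
  shows "dens G f a x =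
      real (card {g \<in> G m. \<forall>l\<in>prime_factors m. red (loc m l) g \<in> Sset G f a l}) / real (card (G m))
      * (\<Prod>l\<in>{l. Factorial_Ring.prime l \<and> l \<le> x} - prime_factors m. delta G f a l)"
proof -
  define P where "P = {l::nat. Factorial_Ring.prime l \<and> l \<le> x}"
  define P1 where "P1 = prime_factors m"
  define P2 where "P2 = P - P1"
  define n2 where "n2 = (\<Prod>l\<in>P2. lev f l)"
  define S where "S = Sset G f a"
  define Gm where "Gm = {g \<in> G m. \<forall>l\<in>P1. red (loc m l) g \<in> S l}"
  define Gn where "Gn = {g \<in> GL2 n2. \<forall>l\<in>P2. red (lev f l) g \<in> S l}"
  have m: "m > 0" unfolding m_def using f by (rule mlev_pos)
  have pf: "P1 = prime_factors (mE G)" unfolding P1_def m_def using f by (rule prime_factors_mlev)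
  have "P \<subseteq> {..x}" unfolding P_def by blast
  then have finP: "finite P" by (rule finite_subset) simp
  \<comment> \<open>A bound x of at least M captures every prime of M.\<close>
  have P1: "P1 \<subseteq> P" unfolding pf P_def using x M by (auto dest!: dvd_imp_le)
  have P: "P = P1 \<union> P2" using P1 unfolding P2_def by blast
  have prime: "Factorial_Ring.prime l" if "l \<in> P" for l using that by (simp add: P_def)
  have finP2: "finite P2" unfolding P2_def using finP by simp
  have P2: "P2 \<subseteq> P" by (simp add: P2_def)
  have loc: "loc m l = lev f l" if "l \<in> P1" for l
    unfolding m_def using loc_mlev[OF f, of l G] that pf by simp
  have Mx: "Mx f x = m * n2"
  proof -
    have "Mx f x = (\<Prod>l\<in>P1 \<union> P2. lev f l)" unfolding Mx_def P[symmetric] P_def ..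
    also have "\<dots> = (\<Prod>l\<in>P1. lev f l) * n2"
      unfolding n2_def using finite_set_mset[of "prime_factorization m"] finP2
      by (intro prod.union_disjoint) (auto simp: P1_def P2_def)
    finally show ?thesis unfolding m_def mlev_eq[OF f] pf .
  qed
  have n2: "n2 > 0" unfolding n2_def using P2 prime lev_pos by (intro prod_pos) blast
  have cop: "coprime (lev f l) (mE G)" if l: "l \<in> P2" for l
  proof -
    have "Factorial_Ring.prime l" "\<not> l dvd mE G"
      using l P2 prime M unfolding P2_def pf by (auto simp: in_prime_factors_iff)
    then show ?thesis by (auto simp: lev_def intro: prime_imp_coprime)
  qed
  have copn: "coprime n2 (mE G)" unfolding n2_def using cop by (rule prod_coprime_left)
  have "coprime (loc m l) n2" if "l \<in> P1" for l
  proof -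
    have "coprime l n2" using copn that pf coprime_divisors[of l "mE G" n2 n2] by (auto simp: coprime_commute)
    then show ?thesis by simp
  qed
  then have cmn: "coprime m n2" using prod_coprime_left[of P1 "loc m" n2] prod_loc[OF m] unfolding P1_def by simp
  have GMx: "G (m * n2) = {g \<in> GL2 (m * n2). red m g \<in> G m}"
  proof -
    have "\<forall>p. Factorial_Ring.prime p \<longrightarrow> p dvd m \<longrightarrow> p dvd mE G"
      using pf m unfolding P1_def by (metis in_prime_factors_imp_dvd neq0_conv prime_factorsI)
    then show ?thesis using sp m n2 copn unfolding split_level_def by blast
  qed
  have prime2: "Factorial_Ring.prime l" if "l \<in> P2" for l using that P2 prime by blast
  note levpos = lev_pos[OF prime2]
  have GL2lev: "G (lev f l) = GL2 (lev f l)" if "l \<in> P2" for l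
    by (rule G_eq_GL2[OF sp cop[OF that] levpos[OF that]])
  have SGL: "S l \<subseteq> GL2 (lev f l)" if "l \<in> P2" for l
    unfolding S_def GL2lev[OF that, symmetric] by (rule Sset_subset[OF f prime2[OF that]])
  have cl: "pairwise (\<lambda>k l. coprime (lev f k) (lev f l)) P2"
    using prime2 by (rule coprime_lev)
  have dl: "lev f l dvd n2" if "l \<in> P2" for l unfolding n2_def using finP2 that by (rule dvd_prodI)
  have cardGn: "card Gn = (\<Prod>l\<in>P2. card (S l))"
    unfolding Gn_def n2_def using finP2 cl levpos SGL by (rule card_crt)
  have "card {g \<in> GL2 n2. \<forall>l\<in>P2. red (lev f l) g \<in> GL2 (lev f l)} = (\<Prod>l\<in>P2. card (GL2 (lev f l)))"
    unfolding n2_def by (rule card_crt[OF finP2 cl levpos subset_refl])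
  moreover have "{g \<in> GL2 n2. \<forall>l\<in>P2. red (lev f l) g \<in> GL2 (lev f l)} = GL2 n2"
    using red_GL2[OF dl] by blast
  ultimately have cardGL: "card (GL2 n2) = (\<Prod>l\<in>P2. card (G (lev f l)))"
    using GL2lev by simp
  have "card (G (m * n2)) = card {g \<in> GL2 (m * n2). red m g \<in> G m \<and> red n2 g \<in> GL2 n2}"
    unfolding GMx using red_GL2[of n2 "m * n2"] by (intro arg_cong[of _ _ card]) auto
  also have "\<dots> = card (G m) * card (GL2 n2)"
    using cmn m n2 G_subset[OF m] by (rule card_crt2) (rule subset_refl)
  finally have den: "card (G (Mx f x)) = card (G m) * card (GL2 n2)" unfolding Mx .
  have "{g \<in> G (m * n2). \<forall>l. Factorial_Ring.prime l \<and> l \<le> x \<longrightarrow> red (lev f l) g \<in> S l}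
      = {g \<in> GL2 (m * n2). red m g \<in> Gm \<and> red n2 g \<in> Gn}"
  proof -
    have "(\<forall>l. Factorial_Ring.prime l \<and> l \<le> x \<longrightarrow> red (lev f l) g \<in> S l)
        \<longleftrightarrow> (\<forall>l\<in>P1. red (loc m l) (red m g) \<in> S l) \<and> (\<forall>l\<in>P2. red (lev f l) (red n2 g) \<in> S l)" for g
    proof -
      have "(\<forall>l. Factorial_Ring.prime l \<and> l \<le> x \<longrightarrow> red (lev f l) g \<in> S l)
          \<longleftrightarrow> (\<forall>l\<in>P1. red (lev f l) g \<in> S l) \<and> (\<forall>l\<in>P2. red (lev f l) g \<in> S l)"
        using P unfolding P_def by blast
      moreover have "red (loc m l) (red m g) = red (lev f l) g" if "l \<in> P1" for l
        using red_red[OF loc_dvd[of l m], of g] loc[OF that] by simp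
      moreover have "red (lev f l) (red n2 g) = red (lev f l) g" if "l \<in> P2" for l
        using red_red[OF dl[OF that]] .
      ultimately show ?thesis by simp
    qed
    then show ?thesis unfolding GMx Gm_def Gn_def using red_GL2[of n2 "m * n2"] by auto
  qed
  then have "card {g \<in> G (Mx f x). \<forall>l. Factorial_Ring.prime l \<and> l \<le> x \<longrightarrow> red (lev f l) g \<in> S l}
      = card {g \<in> GL2 (m * n2). red m g \<in> Gm \<and> red n2 g \<in> Gn}"
    unfolding Mx by simp
  also have "\<dots> = card Gm * card Gn"
    using cmn m n2 by (rule card_crt2) (use G_subset[OF m] in \<open>auto simp: Gm_def Gn_def\<close>)
  finally have num: "card {g \<in> G (Mx f x). \<forall>l. Factorial_Ring.prime l \<and> l \<le> x \<longrightarrow> red (lev f l) g \<in> S l}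
      = card Gm * card Gn" .
  have "dens G f a x = real (card Gm) / real (card (G m)) * (\<Prod>l\<in>P2. delta G f a l)"
    unfolding dens_def num[unfolded S_def] den cardGn cardGL delta_def S_def
    by (simp add: prod_dividef)
  then show ?thesis unfolding Gm_def P1_def P2_def P_def S_def .
qed

text \<open>Here the local image is all of GL2 and only the identity is removed, so
  \<open>delta\<close> is 1 minus the inverse of the order of GL2 at level l.\<close>

lemma delta_generic:
  assumes "split_level G n" "Factorial_Ring.prime l" "\<not> l dvd n" "\<not> l dvd f"
  shows "\<bar>delta G f a l - 1\<bar> \<le> inverse (real l ^ 2)"
proof -
  have l: "l > 0" using assms(2) by (rule prime_gt_0_nat)
  have "coprime l n" using assms(2,3) by (rule prime_imp_coprime)
  then have GL: "G l = GL2 l" using G_eq_GL2[OF assms(1)] l by blast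
  have "card (GL2 l - {ident l}) = card (GL2 l) - 1"
    using ident_GL2 by (rule card_Diff_singleton)
  moreover have ge: "l\<^sup>2 \<le> card (GL2 l)" using l by (rule card_GL2_ge)
  moreover have l2: "l\<^sup>2 > 0" using l by simp
  \<comment> \<open>Positivity ensures that the subtraction of 1 in the naturals is not
    truncated.\<close>
  moreover have "card (GL2 l) > 0" using ge l2 by linarith
  ultimately have "delta G f a l = 1 - 1 / real (card (GL2 l))"
    unfolding delta_def Sset_def lev_not_dvd[OF assms(4)] GL using assms(4)
    by (simp add: of_nat_diff diff_divide_distrib)
  then have "\<bar>delta G f a l - 1\<bar> = inverse (real (card (GL2 l)))" by (simp add: divide_inverse)
  also have "\<dots> \<le> inverse (real (l\<^sup>2))"
    using ge l2 by (intro le_imp_inverse_le) (simp_all only: of_nat_le_iff of_nat_0_less_iff)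
  finally show ?thesis by simp
qed

text \<open>Comparison with the sum of 1 / l^2, valid beyond n and f. Some factors may be 0, for
  instance at a prime dividing f and a but not n; \<open>convergent_prod\<close> tolerates finitely
  many of these.\<close>

lemma convergent_prod_delta:
  assumes "split_level G n" "n > 0" "f > 0"
  shows "convergent_prod (\<lambda>l. if Factorial_Ring.prime l then delta G f a l else 1)"
proof -
  have "eventually (\<lambda>l. norm (norm ((if Factorial_Ring.prime l then delta G f a l else 1) - 1)) \<le> inverse (real l ^ 2)) sequentially"
    using eventually_gt_at_top[of "max n f"]
  proof eventually_elim
    case (elim l)
    then have "\<not> l dvd n" "\<not> l dvd f" using assms(2,3) by (auto dest: dvd_imp_le)
    then show ?case using delta_generic[OF assms(1)] by auto
  qed
  moreover have "summable (\<lambda>l. inverse (real l ^ 2))" by (rule inverse_power_summable) simp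
  ultimately have "summable (\<lambda>l. norm ((if Factorial_Ring.prime l then delta G f a l else 1) - 1))"
    by (rule summable_comparison_test_ev)
  then show ?thesis
    by (intro abs_convergent_prod_imp_convergent_prod summable_imp_abs_convergent_prod)
qed

end

text \<open>The curve is represented by its compatible system of finite images. Without complex
  multiplication, a split and stable level exists by Serre's open image theorem, which makes the
  adelic image the full preimage of its image at some finite level.\<close>

theorem theorem5p1:
  fixes G :: "nat \<Rightarrow> m2 set" and f :: nat and a :: int
  assumes "compatible_system G"
    and "\<exists>n>0. split_level G n \<and> stable_level G n"
    and "abelian_entanglements G"
    and "0 < f"
    and "\<forall>l\<in>prime_factors (mlev G f). Sset G f a l \<noteq> {}"
  shows "(\<lambda>x. complex_of_real (dens G f a x)) \<longlonglongrightarrow>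
           frakC G f a * complex_of_real (prodinf (\<lambda>l::nat. if Factorial_Ring.prime l then delta G f a l else 1))"
proof -
  interpret compatible G by unfold_locales (rule assms(1))
  note M = mE_split_stable[OF assms(2)]
  define m where "m = mlev G f"
  define h where "h l = (if Factorial_Ring.prime l then delta G f a l else 1)" for l :: nat
  have m: "m > 0" unfolding m_def using assms(4) by (rule mlev_pos)
  have pf: "prime_factors m = prime_factors (mE G)"
    unfolding m_def using assms(4) by (rule prime_factors_mlev)
  have loc: "loc m l = lev f l" if "l \<in> prime_factors m" for l
    using that unfolding pf unfolding m_def by (rule loc_mlev[OF assms(4)])
  have comm: "\<exists>h\<in>G m. mmul m x y = mmul m h (mmul m y x)" if "x \<in> calG G m" "y \<in> calG G m" for x y
    by (rule calG_commutator[OF refl M(1) assms(3) M(3) m pf that])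
  have S: "Sset G f a l \<subseteq> G (loc m l)" if "l \<in> prime_factors m" for l
    unfolding loc[OF that] using that by (intro Sset_subset[OF assms(4)]) auto
  have ne: "Sset G f a l \<noteq> {}" if "l \<in> prime_factors m" for l
    using assms(5) that unfolding m_def by blast
  have "complex_of_real (real (card {g \<in> G m. \<forall>l\<in>prime_factors m. red (loc m l) g \<in> Sset G f a l}) / real (card (G m)))
      = frakC G f a * complex_of_real (\<Prod>l\<in>prime_factors m. real (card (Sset G f a l)) / real (card (G (loc m l))))"
    unfolding frakC_def Echi_def m_def[symmetric] using m comm S ne by (rule density_by_characters)
  also have "(\<Prod>l\<in>prime_factors m. real (card (Sset G f a l)) / real (card (G (loc m l))))
      = (\<Prod>l\<in>prime_factors m. delta G f a l)"
    by (intro prod.cong refl) (simp add: delta_def loc)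
  finally have dm: "complex_of_real (real (card {g \<in> G m. \<forall>l\<in>prime_factors m. red (loc m l) g \<in> Sset G f a l}) / real (card (G m)))
      = frakC G f a * complex_of_real (\<Prod>l\<in>prime_factors m. delta G f a l)" .
  \<comment> \<open>From \<open>mE G\<close> on, the contribution of the primes of m no longer
    changes; joined with the remaining primes it turns the density into a constant times a partial
    product.\<close>
  have dens: "complex_of_real (dens G f a x) = frakC G f a * complex_of_real (\<Prod>l\<le>x. h l)" if x: "mE G \<le> x" for x
  proof -
    define P where "P = {l::nat. Factorial_Ring.prime l \<and> l \<le> x}"
    have "prime_factors m \<subseteq> P"
      unfolding pf P_def using x M(1) by (auto dest!: dvd_imp_le)
    moreover have P: "P = {l \<in> {..x}. Factorial_Ring.prime l}" unfolding P_def by blast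
    then have "finite P" by simp
    ultimately have "(\<Prod>l\<in>prime_factors m. delta G f a l) * (\<Prod>l\<in>P - prime_factors m. delta G f a l) = (\<Prod>l\<in>P. delta G f a l)"
      using prod.subset_diff[of "prime_factors m" P "delta G f a"] by (simp add: mult.commute)
    also have "\<dots> = (\<Prod>l\<le>x. h l)"
      unfolding P h_def by (rule prod.inter_filter) simp
    finally have P_prod: "(\<Prod>l\<in>prime_factors m. delta G f a l) * (\<Prod>l\<in>P - prime_factors m. delta G f a l) = (\<Prod>l\<le>x. h l)" .
    have "complex_of_real (dens G f a x)
        = frakC G f a * complex_of_real (\<Prod>l\<in>prime_factors m. delta G f a l)
          * complex_of_real (\<Prod>l\<in>P - prime_factors m. delta G f a l)"
      unfolding dens_eq[OF assms(4) M(1,2) x] m_def[symmetric] P_def[symmetric] of_real_mult dm ..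
    then show ?thesis unfolding P_prod[symmetric] of_real_mult by (simp add: mult.assoc)
  qed
  have "(\<lambda>x. \<Prod>l\<le>x. h l) \<longlonglongrightarrow> prodinf h"
    by (rule convergent_prod_LIMSEQ) (use convergent_prod_delta[OF M(2,1) assms(4)] in \<open>simp add: h_def[abs_def]\<close>)
  then have "(\<lambda>x. frakC G f a * complex_of_real (\<Prod>l\<le>x. h l)) \<longlonglongrightarrow> frakC G f a * complex_of_real (prodinf h)"
    by (intro tendsto_intros)
  moreover have "eventually (\<lambda>x. frakC G f a * complex_of_real (\<Prod>l\<le>x. h l) = complex_of_real (dens G f a x)) sequentially"
    using eventually_ge_at_top[of "mE G"] by eventually_elim (simp add: dens)
  ultimately have "(\<lambda>x. complex_of_real (dens G f a x)) \<longlonglongrightarrow> frakC G f a * complex_of_real (prodinf h)"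
    by (rule Lim_transform_eventually)
  then show ?thesis unfolding h_def[abs_def] .
qed

end
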